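(* For every integer $n\ge 2$ and every real $p$ with $0<p<\infty$, the function $$A\mapsto \|A\|_{H^p} = \left(\int_{S^{n-1}} |Ax|^p \,d\mu(x)\right)^{1/p}$$ is an orthogonally invariant norm on the real vector space $\mathbb R^{n\times n}$ of real $n\times n$ matrices.
   Context: Here $S^{n-1}$ is the unit sphere of $\mathbb R^n$, $\mu$ is the normalized (total mass $1$) surface measure on $S^{n-1}$, and $|\cdot|$ is the Euclidean norm on $\mathbb R^n$. A norm $\|\cdot\|$ on $\mathbb R^{n\times n}$ is orthogonally invariant if $\|UAV\|=\|A\|$ for all $A\in\mathbb R^{n\times n}$ and all orthogonal $n\times n$ matrices $U,V$. "Norm" means a vector space norm (no submultiplicativity is required). *)

theory Defs
  imports "HOL-Analysis.Analysis"
begin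

text \<open>
  Surface measure on the unit sphere, defined by polar coordinates: a Borel set \<open>E\<close> of the
  sphere has measure \<open>n * \<lambda> {x. 0 < |x| < 1 \<and> x / |x| \<in> E}\<close>, where \<open>n\<close> is the
  dimension and \<open>\<lambda>\<close> is Lebesgue measure (see \<open>emeasure_sphere_surface\<close>).  The factor
  \<open>n\<close> is what makes \<open>dx = r^(n-1) dr d\<sigma>\<close>.
\<close>

definition sphere_surface :: "'a::euclidean_space measure" where
  "sphere_surface =
     scale_measure (of_nat DIM('a))
       (distr (restrict_space lborel {x. 0 < norm x \<and> norm x < 1})
              (restrict_space borel (sphere 0 1))
              (\<lambda>x. x /\<^sub>R norm x))"

lemma space_sphere_surface: "space (sphere_surface :: 'a::euclidean_space measure) = sphere 0 1"
  by (simp add: sphere_surface_def space_scale_measure space_restrict_space)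

lemma sets_sphere_surface:
  "sets (sphere_surface :: 'a::euclidean_space measure) = sets (restrict_space borel (sphere 0 1))"
  by (simp add: sphere_surface_def)

lemma emeasure_sphere_surface:
  fixes E :: "'a::euclidean_space set"
  assumes "E \<in> sets borel" "E \<subseteq> sphere 0 1"
  shows "emeasure sphere_surface E =
    of_nat DIM('a) * emeasure lborel {x. 0 < norm x \<and> norm x < 1 \<and> x /\<^sub>R norm x \<in> E}"
proof -
  let ?B = "{x::'a. 0 < norm x \<and> norm x < 1}"
  let ?M = "restrict_space lborel ?B"
  let ?N = "restrict_space borel (sphere (0::'a) 1)"
  have B: "?B \<in> sets lborel" by measurable
  have meas: "(\<lambda>x. x /\<^sub>R norm x) \<in> ?M \<rightarrow>\<^sub>M ?N"
  proof (rule measurable_restrict_space2)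
    show "(\<lambda>x. x /\<^sub>R norm x) \<in> space ?M \<rightarrow> sphere 0 1"
      by (auto simp: space_restrict_space)
    have "(\<lambda>x::'a. x /\<^sub>R norm x) \<in> lborel \<rightarrow>\<^sub>M borel" by measurable
    then show "(\<lambda>x. x /\<^sub>R norm x) \<in> ?M \<rightarrow>\<^sub>M borel"
      by (rule measurable_restrict_space1)
  qed
  have E: "E \<in> sets ?N"
    using assms by (auto simp: sets_restrict_space)
  have "emeasure (distr ?M ?N (\<lambda>x. x /\<^sub>R norm x)) E
      = emeasure ?M ((\<lambda>x. x /\<^sub>R norm x) -` E \<inter> space ?M)"
    by (rule emeasure_distr[OF meas E])
  also have "\<dots> = emeasure lborel ((\<lambda>x. x /\<^sub>R norm x) -` E \<inter> space ?M)"
    by (rule emeasure_restrict_space) (use B in \<open>auto simp: space_restrict_space\<close>)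
  also have "(\<lambda>x. x /\<^sub>R norm x) -` E \<inter> space ?M
      = {x. 0 < norm x \<and> norm x < 1 \<and> x /\<^sub>R norm x \<in> E}"
    by (auto simp: space_restrict_space)
  finally show ?thesis
    by (simp add: sphere_surface_def)
qed

definition sphere_prob :: "'a::euclidean_space measure" where
  "sphere_prob = uniform_measure sphere_surface (sphere 0 1)"

lemma emeasure_sphere_prob_total:
  "emeasure (sphere_prob :: 'a::euclidean_space measure) (sphere 0 1) = 1"
proof -
  have eq: "{x::'a. 0 < norm x \<and> norm x < 1 \<and> x /\<^sub>R norm x \<in> sphere 0 1} = ball 0 1 - {0}"
    by auto
  have "emeasure lborel (ball (0::'a) 1 - {0}) = emeasure lborel (ball (0::'a) 1)"
    by (subst emeasure_Diff) auto
  then have tot: "emeasure sphere_surface (sphere (0::'a) 1)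
      = of_nat DIM('a) * emeasure lborel (ball (0::'a) 1)"
    by (subst emeasure_sphere_surface) (simp_all only: eq, auto)
  have fin: "emeasure lborel (ball (0::'a) 1) \<noteq> \<infinity>"
    using emeasure_lborel_ball_finite[of "0::'a" 1] by (simp add: less_top)
  have pos: "emeasure lborel (ball (0::'a) 1) \<noteq> 0"
    using content_ball_pos[of 1 "0::'a"] by (auto simp: measure_def)
  have "emeasure sphere_surface (sphere (0::'a) 1) \<noteq> 0"
    using tot pos by simp
  moreover have "emeasure sphere_surface (sphere (0::'a) 1) \<noteq> \<infinity>"
    using tot fin by (simp add: ennreal_mult_eq_top_iff)
  ultimately show ?thesis
    unfolding sphere_prob_def by (rule emeasure_uniform_measure_1)
qed

definition Hp_norm :: "real \<Rightarrow> real^'n^'n \<Rightarrow> real" where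
  "Hp_norm p A = (\<integral>x. norm (A *v x) powr p \<partial>sphere_prob) powr (1 / p)"

definition is_norm :: "('a::real_vector \<Rightarrow> real) \<Rightarrow> bool" where
  "is_norm N \<longleftrightarrow>
     (\<forall>x. 0 \<le> N x) \<and>
     (\<forall>x. N x = 0 \<longleftrightarrow> x = 0) \<and>
     (\<forall>c x. N (c *\<^sub>R x) = \<bar>c\<bar> * N x) \<and>
     (\<forall>x y. N (x + y) \<le> N x + N y)"

definition orthogonally_invariant :: "(real^'n^'n \<Rightarrow> real) \<Rightarrow> bool" where
  "orthogonally_invariant N \<longleftrightarrow>
     (\<forall>A U V. orthogonal_matrix U \<longrightarrow> orthogonal_matrix V \<longrightarrow> N (U ** A ** V) = N A)"

end

theory Submission
  imports Defs
begin

text \<open>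
  For \<open>p \<ge> 1\<close> the triangle inequality is Minkowski's. For \<open>0 < p < 1\<close> replace \<open>|Ax|\<close> by
  \<open>|(Ax, \<epsilon>x)|\<close>, so that all maps are injective, and show that \<open>(\<integral> |fx + t gx|\<^sup>p)\<close> to the power
  \<open>1/p\<close> has nonnegative second derivative in \<open>t\<close>. In an orthonormal basis \<open>v\<close> of right singular
  vectors of \<open>f\<close>, with \<open>u\<^sub>v = |fv|\<^sup>2\<close>, \<open>F = \<integral> |fx|\<^sup>p\<close>, \<open>P\<^sub>v = \<integral> x\<^sub>v\<^sup>2 |fx|\<^sup>p\<^sup>-\<^sup>2\<close> and
  \<open>W\<^sub>v\<^sub>w = \<integral> x\<^sub>v\<^sup>2 x\<^sub>w\<^sup>2 |fx|\<^sup>p\<^sup>-\<^sup>4\<close>, odd moments vanish and the Hessian is nonnegative as soon as,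
  for each pair \<open>v \<noteq> w\<close>, \<open>(1 - p) P\<^sub>v P\<^sub>w \<le> (2 - p) F W\<^sub>v\<^sub>w\<close> (diagonal directions) and
  \<open>(2 - p) W\<^sub>v\<^sub>w (u\<^sub>v P\<^sub>v + u\<^sub>w P\<^sub>w) \<le> P\<^sub>v P\<^sub>w\<close> (off-diagonal directions).
  Averaging over rotations of the plane of \<open>v\<close> and \<open>w\<close> reduces both to a circle carrying
  \<open>q = U\<^sup>2 cos\<^sup>2 + V\<^sup>2 sin\<^sup>2\<close>, where both become equalities for \<open>p = 0\<close>; the general case is a comparison
  of \<open>q\<^sup>p\<^sup>/\<^sup>2\<close> with \<open>U\<^sup>p\<close>, \<open>V\<^sup>p\<close> and \<open>(UV)\<^sup>p\<^sup>/\<^sup>2\<close>. The circle inequalities survive the averaging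
  because they say that certain quadratic forms, linear in the averages, are nonnegative.
\<close>

subsection \<open>Measures on compact sets\<close>

text \<open>Serves both the sphere and the interval of angles. Every function continuous on the
  compact carrier is bounded, hence integrable, which settles integrability in what follows.\<close>

locale compact_measure = finite_measure M
  for M :: "'a::euclidean_space measure" +
  fixes S :: "'a set"
  assumes compact_S: "compact S"
    and space_M: "space M = S"
    and sets_M: "sets M = sets (restrict_space borel S)"
begin

lemma id_measurable: "(\<lambda>x. x) \<in> M \<rightarrow>\<^sub>M borel"
  using measurable_restrict_space1[OF measurable_ident, of borel S]
  by (simp add: measurable_cong_sets[OF sets_M refl] id_def)

lemma integrable_continuous:
  fixes f :: "'a \<Rightarrow> real"
  assumes "continuous_on S f"
  shows "integrable M f"
proof -
  obtain K where K: "\<And>x. x \<in> S \<Longrightarrow> norm (f x) \<le> K"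
    using continuous_on_compact_bound[OF compact_S assms] by blast
  have "f \<in> borel_measurable M"
    using borel_measurable_continuous_on_restrict[OF assms]
    by (simp add: measurable_cong_sets[OF sets_M refl])
  then show ?thesis
    using K by (intro integrable_const_bound[of f K]) (auto simp: space_M)
qed

text \<open>Dominated convergence for difference quotients: \<open>F'\<close> is bounded by some
  \<open>K\<close> on the compact set \<open>{t-1..t+1} \<times> S\<close>, and the mean value
  theorem carries \<open>K\<close> over to the quotients.\<close>

lemma has_derivative_integral:
  fixes F F' :: "real \<Rightarrow> 'a \<Rightarrow> real"
  assumes der: "\<And>x t. x \<in> S \<Longrightarrow> ((\<lambda>t. F t x) has_real_derivative F' t x) (at t)"
    and contF: "\<And>t. continuous_on S (F t)"
    and contF': "continuous_on (UNIV \<times> S) (\<lambda>(t, x). F' t x)"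
  shows "((\<lambda>t. \<integral>x. F t x \<partial>M) has_real_derivative (\<integral>x. F' t x \<partial>M)) (at t)"
proof -
  have "compact ({t-1..t+1} \<times> S)"
    by (intro compact_Times compact_Icc compact_S)
  then obtain K where K: "\<And>z. z \<in> {t-1..t+1} \<times> S \<Longrightarrow> norm (case z of (t, x) \<Rightarrow> F' t x) \<le> K"
    using continuous_on_compact_bound[of "{t-1..t+1} \<times> S" "\<lambda>(t, x). F' t x"]
      continuous_on_subset[OF contF', of "{t-1..t+1} \<times> S"] by blast
  have intF: "integrable M (F s)" for s
    by (intro integrable_continuous contF)
  have contF't: "continuous_on S (F' t)"
  proof -
    have "continuous_on S ((\<lambda>(t, x). F' t x) \<circ> (\<lambda>x. (t, x)))"
      by (intro continuous_on_compose continuous_intros continuous_on_subset[OF contF']) auto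
    then show ?thesis by (simp add: o_def)
  qed
  have bound: "\<bar>(F s x - F t x) / (s - t)\<bar> \<le> K" if "s \<noteq> t" "\<bar>s - t\<bar> \<le> 1" "x \<in> S" for s x
  proof -
    have "\<bar>F s x - F t x\<bar> \<le> K * \<bar>s - t\<bar>"
    proof -
      have "norm (F s x - F t x) \<le> K * norm (s - t)"
        by (rule field_differentiable_bound[where S="{t-1..t+1}" and f' = "\<lambda>t. F' t x"])
          (use that K[of "(_, x)"] in \<open>auto intro!: has_field_derivative_at_within der simp: abs_le_iff\<close>)
      then show ?thesis by simp
    qed
    then show ?thesis using that by (simp add: abs_divide divide_le_eq)
  qed
  show ?thesis
    unfolding has_field_derivative_iff tendsto_at_iff_sequentially
  proof (intro allI impI)
    fix X :: "nat \<Rightarrow> real"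
    assume X: "\<forall>i. X i \<in> UNIV - {t}" and lim: "X \<longlonglongrightarrow> t"
    \<comment> \<open>The quotients are bounded only within distance 1 of \<open>t\<close>, so the
      first \<open>N\<close> terms of the sequence are skipped.\<close>
    have "\<forall>\<^sub>F n in sequentially. dist (X n) t < 1"
      using lim by (rule tendstoD) simp
    then obtain N where N: "\<And>n. n \<ge> N \<Longrightarrow> \<bar>X n - t\<bar> < 1"
      by (auto simp: eventually_sequentially dist_real_def)
    have "(\<lambda>n. \<integral>x. (F (X (n + N)) x - F t x) / (X (n + N) - t) \<partial>M) \<longlonglongrightarrow> (\<integral>x. F' t x \<partial>M)"
    proof (rule integral_dominated_convergence[where w = "\<lambda>_. K"])
      show "F' t \<in> borel_measurable M"
        using integrable_continuous[OF contF't] by auto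
      show "(\<lambda>x. (F (X (n + N)) x - F t x) / (X (n + N) - t)) \<in> borel_measurable M" for n
        using intF by (intro borel_measurable_divide borel_measurable_diff) auto
      show "AE x in M. (\<lambda>n. (F (X (n + N)) x - F t x) / (X (n + N) - t)) \<longlonglongrightarrow> F' t x"
      proof (intro AE_I2)
        fix x assume "x \<in> space M"
        then have "((\<lambda>s. (F s x - F t x) / (s - t)) \<longlongrightarrow> F' t x) (at t)"
          using der[of x t] by (simp add: has_field_derivative_iff space_M)
        then have "((\<lambda>s. (F s x - F t x) / (s - t)) \<circ> X) \<longlonglongrightarrow> F' t x"
          using X lim unfolding tendsto_at_iff_sequentially by blast
        then show "(\<lambda>n. (F (X (n + N)) x - F t x) / (X (n + N) - t)) \<longlonglongrightarrow> F' t x"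
          unfolding o_def by (rule LIMSEQ_ignore_initial_segment)
      qed
      show "AE x in M. norm ((F (X (n + N)) x - F t x) / (X (n + N) - t)) \<le> K" for n
        using X N[of "n + N"] bound by (intro AE_I2) (auto simp: space_M less_imp_le)
    qed simp
    moreover have "(\<integral>x. (F s x - F t x) / (s - t) \<partial>M) = ((\<integral>x. F s x \<partial>M) - (\<integral>x. F t x \<partial>M)) / (s - t)" for s
      by (simp add: Bochner_Integration.integral_diff[OF intF intF])
    ultimately have "(\<lambda>n. ((\<lambda>s. ((\<integral>x. F s x \<partial>M) - (\<integral>x. F t x \<partial>M)) / (s - t)) \<circ> X) (n + N)) \<longlonglongrightarrow> (\<integral>x. F' t x \<partial>M)"
      by (simp only: o_def)
    then show "((\<lambda>s. ((\<integral>x. F s x \<partial>M) - (\<integral>x. F t x \<partial>M)) / (s - t)) \<circ> X) \<longlonglongrightarrow> (\<integral>x. F' t x \<partial>M)"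
      by (rule LIMSEQ_offset)
  qed
qed

end

text \<open>A continuous function on a compact product is bounded, hence integrable for the finite
  product measure, and Fubini applies.\<close>

lemma integral_swap_continuous:
  fixes f :: "'a::euclidean_space \<Rightarrow> 'b::euclidean_space \<Rightarrow> real"
  assumes "compact_measure M S" "compact_measure N T"
    and cont: "continuous_on (S \<times> T) (\<lambda>(x, y). f x y)"
  shows "(\<integral>y. (\<integral>x. f x y \<partial>M) \<partial>N) = (\<integral>x. (\<integral>y. f x y \<partial>N) \<partial>M)"
proof -
  interpret M: compact_measure M S by fact
  interpret N: compact_measure N T by fact
  interpret pair_sigma_finite M N ..
  interpret P: finite_measure "M \<Otimes>\<^sub>M N"
    by (rule finite_measure_pair_measure) unfold_locales
  have "compact (S \<times> T)"
    by (intro compact_Times M.compact_S N.compact_S)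
  then obtain K where K: "\<And>z. z \<in> S \<times> T \<Longrightarrow> norm (case_prod f z) \<le> K"
    using continuous_on_compact_bound[OF _ cont] by blast
  \<comment> \<open>Joint measurability: \<open>f\<close> is Borel on \<open>S \<times> T\<close>
    only, so the identity is first shown measurable into that restricted Borel space.\<close>
  have "(\<lambda>z. (fst z, snd z)) \<in> M \<Otimes>\<^sub>M N \<rightarrow>\<^sub>M borel"
    using measurable_compose[OF measurable_fst M.id_measurable, of N]
      measurable_compose[OF measurable_snd N.id_measurable, of M]
    by (intro borel_measurable_Pair) auto
  then have "(\<lambda>z. z) \<in> M \<Otimes>\<^sub>M N \<rightarrow>\<^sub>M restrict_space borel (S \<times> T)"
    by (intro measurable_restrict_space2) (auto simp: space_pair_measure M.space_M N.space_M)
  from measurable_compose[OF this borel_measurable_continuous_on_restrict[OF cont]]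
  have "case_prod f \<in> borel_measurable (M \<Otimes>\<^sub>M N)" by (simp add: case_prod_unfold)
  then have "integrable (M \<Otimes>\<^sub>M N) (case_prod f)"
    using K by (intro P.integrable_const_bound[of _ K])
      (auto simp: space_pair_measure M.space_M N.space_M)
  then show ?thesis by (rule Fubini_integral)
qed

section \<open>Rotation-invariant measures on the sphere\<close>

locale invariant_sphere_measure = compact_measure M "sphere 0 1"
  for M :: "'a::euclidean_space measure" +
  assumes distr_orthogonal: "orthogonal_transformation T \<Longrightarrow> distr M M T = M"
    and total_pos: "measure M (sphere 0 1) > 0"
begin

lemma measurable_orthogonal:
  assumes "orthogonal_transformation T"
  shows "T \<in> M \<rightarrow>\<^sub>M M"
proof -
  have "T \<in> borel \<rightarrow>\<^sub>M borel"
    using assms by (intro borel_measurable_continuous_onI linear_continuous_on)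
      (simp add: orthogonal_transformation_linear flip: linear_conv_bounded_linear)
  from measurable_compose[OF id_measurable this] have "T \<in> M \<rightarrow>\<^sub>M borel" .
  then have "T \<in> M \<rightarrow>\<^sub>M restrict_space borel (sphere 0 1)"
    by (rule measurable_restrict_space2[rotated])
      (auto simp: space_M orthogonal_transformation_norm[OF assms])
  then show ?thesis by (simp add: measurable_cong_sets[OF refl sets_M])
qed

lemma integral_orthogonal:
  fixes f :: "'a \<Rightarrow> real"
  assumes "orthogonal_transformation T" "continuous_on (sphere 0 1) f"
  shows "(\<integral>x. f (T x) \<partial>M) = (\<integral>x. f x \<partial>M)"
  using integral_distr[OF measurable_orthogonal[OF assms(1)], of f]
    integrable_continuous[OF assms(2)] distr_orthogonal[OF assms(1)] by auto

end

lemma nn_integral_lborel_reflect: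
  fixes g :: "'a::euclidean_space \<Rightarrow> ennreal"
  assumes "g \<in> borel_measurable borel"
  shows "(\<integral>\<^sup>+y. g (t - y) \<partial>lborel) = (\<integral>\<^sup>+y. g y \<partial>lborel)"
proof -
  have eq: "lborel = distr lborel borel (\<lambda>y::'a. t - y)"
    using lborel_affine[of "-1" t] by (simp add: density_1)
  show ?thesis
    by (subst (2) eq) (use assms in \<open>simp add: nn_integral_distr\<close>)
qed

lemma nn_integral_lborel_shift:
  fixes g :: "'a::euclidean_space \<Rightarrow> ennreal"
  assumes "g \<in> borel_measurable borel"
  shows "(\<integral>\<^sup>+y. g (y - t) \<partial>lborel) = (\<integral>\<^sup>+y. g y \<partial>lborel)"
proof -
  have eq: "lborel = distr lborel borel (\<lambda>y::'a. y - t)"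
    using lborel_affine[of 1 "-t"] by (simp add: density_1)
  show ?thesis
    by (subst (2) eq) (use assms in \<open>simp add: nn_integral_distr\<close>)
qed

text \<open>Uniqueness of Haar measure: computing one double integral in two orders gives
  \<open>\<lambda>(T\<^sup>-\<^sup>1 A) \<lambda>(B) = \<lambda>(T\<^sup>-\<^sup>1 B) \<lambda>(A)\<close>, and for the unit ball \<open>T\<^sup>-\<^sup>1 B = B\<close>.  (The library's
  \<open>measure_orthogonal_image\<close> needs a well-ordered index type.)\<close>

lemma emeasure_lborel_orthogonal_vimage:
  fixes T :: "'a::euclidean_space \<Rightarrow> 'a"
  assumes T: "orthogonal_transformation T" and A: "A \<in> sets borel"
  shows "emeasure lborel (T -` A) = emeasure lborel A"
proof -
  let ?B = "ball (0::'a) 1"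
  note nT = orthogonal_transformation_norm[OF T]
  have linT: "linear T" by (rule orthogonal_transformation_linear[OF T])
  have bT [measurable]: "T \<in> borel \<rightarrow>\<^sub>M borel"
    by (intro borel_measurable_continuous_onI linear_continuous_on)
      (simp add: linT flip: linear_conv_bounded_linear)
  have B: "?B \<in> sets borel" by simp
  note [measurable] = A B
  have em: "emeasure lborel (T -` C) = (\<integral>\<^sup>+y. indicator C (T y) \<partial>lborel)" if "C \<in> sets borel" for C
  proof -
    have "(\<lambda>y. indicator C (T y) :: ennreal) = indicator (T -` C)"
      by (auto simp: fun_eq_iff split: split_indicator)
    then show ?thesis using measurable_sets[OF bT that] by simp
  qed
  \<comment> \<open>For fixed \<open>y\<close>, translation invariance gives the measure of
    \<open>D\<close> as the integral over \<open>x\<close> of the indicator of \<open>D\<close> at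
    \<open>x - T y\<close>; then the order of integration is exchanged.\<close>
  have double: "emeasure lborel (T -` C) * emeasure lborel D
      = (\<integral>\<^sup>+x. (\<integral>\<^sup>+y. indicator C (T y) * indicator D (x - T y) \<partial>lborel) \<partial>lborel)"
    if [measurable]: "C \<in> sets borel" "D \<in> sets borel" for C D
  proof -
    have "emeasure lborel (T -` C) * emeasure lborel D
        = (\<integral>\<^sup>+y. indicator C (T y) * (\<integral>\<^sup>+x. indicator D (x - T y) \<partial>lborel) \<partial>lborel)"
      by (subst nn_integral_lborel_shift) (auto simp: em nn_integral_multc)
    also have "\<dots> = (\<integral>\<^sup>+y. (\<integral>\<^sup>+x. indicator C (T y) * indicator D (x - T y) \<partial>lborel) \<partial>lborel)"
      by (intro nn_integral_cong nn_integral_cmult[symmetric]) measurable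
    also have "\<dots> = (\<integral>\<^sup>+x. (\<integral>\<^sup>+y. indicator C (T y) * indicator D (x - T y) \<partial>lborel) \<partial>lborel)"
      by (rule lborel_pair.Fubini') measurable
    finally show ?thesis .
  qed
  have "emeasure lborel (T -` A) * emeasure lborel ?B
      = (\<integral>\<^sup>+x. (\<integral>\<^sup>+y. indicator A (T y) * indicator ?B (x - T y) \<partial>lborel) \<partial>lborel)"
    by (rule double) measurable
  also have "\<dots> = (\<integral>\<^sup>+x. (\<integral>\<^sup>+y. indicator ?B (T y) * indicator A (x - T y) \<partial>lborel) \<partial>lborel)"
  proof (rule nn_integral_cong)
    fix x :: 'a
    \<comment> \<open>Writing \<open>x = T x'\<close> and substituting \<open>x' - y\<close> for
      \<open>y\<close> turns \<open>T y\<close> into \<open>x - T y\<close> and conversely, which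
      swaps the roles of \<open>A\<close> and the ball.\<close>
    obtain x' where x': "x = T x'"
      using orthogonal_transformation_surj[OF T] by (meson surjD)
    have "(\<integral>\<^sup>+y. indicator A (T (x' - y)) * indicator ?B (x - T (x' - y)) \<partial>lborel)
        = (\<integral>\<^sup>+y. indicator A (T y) * (indicator ?B (x - T y) :: ennreal) \<partial>lborel)"
      by (rule nn_integral_lborel_reflect) measurable
    then show "(\<integral>\<^sup>+y. indicator A (T y) * (indicator ?B (x - T y) :: ennreal) \<partial>lborel)
        = (\<integral>\<^sup>+y. indicator ?B (T y) * indicator A (x - T y) \<partial>lborel)"
      by (simp add: x' linear_diff[OF linT] mult.commute)
  qed
  also have "\<dots> = emeasure lborel (T -` ?B) * emeasure lborel A"
    by (rule double[symmetric]) measurable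
  also have "T -` ?B = ?B" by (auto simp: nT)
  finally have eq: "emeasure lborel ?B * emeasure lborel (T -` A) = emeasure lborel ?B * emeasure lborel A"
    by (simp add: mult.commute)
  have "emeasure lborel ?B \<noteq> \<infinity>"
    using emeasure_lborel_ball_finite[of "0::'a" 1] by (simp add: less_top)
  moreover have "emeasure lborel ?B \<noteq> 0"
    using content_ball_pos[of 1 "0::'a"] by (auto simp: measure_def)
  ultimately show ?thesis
    using eq by (simp add: ennreal_mult_cancel_left)
qed

text \<open>An orthogonal \<open>T\<close> preserves norms and commutes with radial projection, so
  the cone over the preimage of \<open>E\<close> is the preimage of the cone over \<open>E\<close>.
  Invariance is thus inherited from Lebesgue measure.\<close>

lemma invariant_sphere_prob: "invariant_sphere_measure (sphere_prob :: 'a::euclidean_space measure)"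
proof -
  let ?M = "sphere_prob :: 'a measure"
  have sp: "space ?M = sphere 0 1"
    by (simp add: sphere_prob_def space_sphere_surface)
  have se: "sets ?M = sets (restrict_space borel (sphere 0 1))"
    by (simp add: sphere_prob_def sets_sphere_surface)
  have fin: "finite_measure ?M"
    by (intro finite_measureI) (simp add: sp emeasure_sphere_prob_total)
  interpret C: compact_measure ?M "sphere 0 1"
    using fin sp se by (simp add: compact_measure_def compact_measure_axioms_def)
  show ?thesis
  proof
    show "measure ?M (sphere 0 1) > 0"
      by (simp add: measure_def emeasure_sphere_prob_total)
    fix T :: "'a \<Rightarrow> 'a"
    assume T: "orthogonal_transformation T"
    note nT = orthogonal_transformation_norm[OF T]
    have T0: "T x = 0 \<longleftrightarrow> x = 0" for x
      by (metis nT norm_eq_zero)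
    have bT: "T \<in> borel \<rightarrow>\<^sub>M borel"
      using T by (intro borel_measurable_continuous_onI linear_continuous_on)
        (simp add: orthogonal_transformation_linear flip: linear_conv_bounded_linear)
    have "T \<in> ?M \<rightarrow>\<^sub>M borel" 
      using measurable_compose[OF C.id_measurable bT] .
    then have "T \<in> ?M \<rightarrow>\<^sub>M restrict_space borel (sphere 0 1)"
      by (rule measurable_restrict_space2[rotated]) (auto simp: sp nT)
    then have mT: "T \<in> ?M \<rightarrow>\<^sub>M ?M" by (simp add: measurable_cong_sets[OF refl se])
    have surf: "emeasure sphere_surface (T -` E \<inter> sphere 0 1) = emeasure sphere_surface E"
      if E: "E \<in> sets borel" "E \<subseteq> sphere 0 1" for E
    proof -
      let ?A = "\<lambda>E. {x::'a. 0 < norm x \<and> norm x < 1 \<and> x /\<^sub>R norm x \<in> E}"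
      have TE: "T -` E \<inter> sphere 0 1 \<in> sets borel"
        using measurable_sets[OF bT E(1)] by auto
      have A_borel: "?A E \<in> sets borel" if "E \<in> sets borel" for E
        using that by measurable
      have TA: "?A (T -` E \<inter> sphere 0 1) = T -` ?A E"
        using orthogonal_transformation_scaleR[OF T] by (auto simp: nT T0)
      show ?thesis
        using emeasure_lborel_orthogonal_vimage[OF T A_borel[OF E(1)]]
        by (simp only: emeasure_sphere_surface[OF E] emeasure_sphere_surface[OF TE Int_lower2] TA)
    qed
    show "distr ?M ?M T = ?M"
    proof (rule measure_eqI)
      fix E assume "E \<in> sets (distr ?M ?M T)"
      then have E': "E \<in> sets ?M" by simp
      then have E: "E \<in> sets borel" "E \<subseteq> sphere 0 1"
        by (auto simp: se sets_restrict_space_iff)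
      have TE: "T -` E \<inter> sphere 0 1 \<in> sets ?M"
        using measurable_sets[OF mT E'] by (simp add: sp)
      have EE: "sphere 0 1 \<inter> (T -` E \<inter> sphere 0 1) = T -` E \<inter> sphere 0 1" "sphere 0 1 \<inter> E = E"
        using E by auto
      have sS: "sphere 0 1 \<in> sets (sphere_surface :: 'a measure)"
        by (metis sets.top space_sphere_surface)
      have "emeasure (distr ?M ?M T) E = emeasure ?M (T -` E \<inter> sphere 0 1)"
        using emeasure_distr[OF mT E'] by (simp add: sp)
      also have "\<dots> = emeasure ?M E"
        using E' TE surf[OF E] sS EE unfolding sphere_prob_def
        by (simp add: emeasure_uniform_measure)
      finally show "emeasure (distr ?M ?M T) E = emeasure ?M E" .
    qed simp
  qed
qed

subsection \<open>A convexity inequality on the circle\<close>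

text \<open>A circle is represented by its angle, with total mass \<open>2 * pi\<close>. The
  interval is closed so that the carrier is compact; the doubled endpoint is a null set.\<close>

definition circle :: "real measure" where
  "circle = restrict_space lborel {0..2*pi}"

lemma compact_measure_circle: "compact_measure circle {0..2*pi}"
proof (intro compact_measure.intro compact_measure_axioms.intro finite_measureI)
  show "emeasure circle (space circle) \<noteq> \<infinity>"
    by (simp add: circle_def emeasure_restrict_space space_restrict_space)
qed (auto simp: circle_def space_restrict_space sets_restrict_space)

interpretation circle: compact_measure circle "{0..2*pi}"
  by (rule compact_measure_circle)

lemma integrable_circle: "continuous_on UNIV f \<Longrightarrow> integrable circle f"
  for f :: "real \<Rightarrow> real"
  by (rule circle.integrable_continuous) (rule continuous_on_subset, auto)

text \<open>The source of every exact identity on the circle: exhibit a periodic primitive.\<close>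

lemma integral_circle_deriv:
  assumes "\<And>t. (F has_real_derivative f t) (at t)" "continuous_on UNIV f" "F (2 * pi) = F 0"
  shows "(\<integral>t. f t \<partial>circle) = 0"
proof -
  have "(\<integral>t. f t \<partial>circle) = (\<integral>t. indicator {0..2*pi} t *\<^sub>R f t \<partial>lborel)"
    unfolding circle_def by (rule integral_restrict_space) auto
  also have "\<dots> = F (2 * pi) - F 0"
    using assms by (intro integral_FTC_Icc)
      (auto intro: continuous_on_subset has_vector_derivative_at_within
        simp: has_real_derivative_iff_has_vector_derivative)
  finally show ?thesis using assms by simp
qed

text \<open>With \<open>x = exp s\<close> this reads \<open>sinh (p s) \<le> p sinh s\<close>. Both
  sides vanish at 1, and the derivatives compare because \<open>z + 1 / z\<close> increases for
  \<open>z \<ge> 1\<close> and \<open>1 \<le> y powr p \<le> y\<close>.\<close>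

lemma powr_diff_inverse_le:
  fixes p x :: real
  assumes "0 < p" "p \<le> 1" "1 \<le> x"
  shows "x powr p - x powr (- p) \<le> p * (x - 1 / x)"
proof -
  define h where "h = (\<lambda>x::real. p * (x - 1 / x) - (x powr p - x powr (- p)))"
  have "h 1 \<le> h x"
  proof (rule DERIV_nonneg_imp_nondecreasing[OF assms(3)], intro exI conjI)
    fix y :: real assume y: "1 \<le> y"
    show "(h has_real_derivative p * (1 + 1 / y\<^sup>2) - (p * y powr (p - 1) + p * y powr (- p - 1))) (at y)"
    proof -
      have inv: "((\<lambda>x. 1 / x) has_real_derivative - (1 / y\<^sup>2)) (at y)"
        using y by (auto intro!: derivative_eq_intros simp: power2_eq_square)
      have "((\<lambda>x. x powr r) has_real_derivative r * y powr (r - 1)) (at y)" for r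
        using y by (intro has_real_derivative_powr) auto
      from DERIV_diff[OF DERIV_cmult[OF DERIV_diff[OF DERIV_ident inv]] DERIV_diff[OF this this]]
      show ?thesis unfolding h_def by (rule DERIV_cong) simp
    qed
    have "y powr (p - 1) + y powr (- p - 1) = (y powr p + 1 / y powr p) / y"
      using y by (simp add: powr_diff powr_minus_divide add_divide_distrib)
    also have "y powr p + 1 / y powr p \<le> y + 1 / y"
    proof -
      define z where "z = y powr p"
      have z: "1 \<le> z" "z \<le> y"
        using y assms powr_mono[of p 1 y] by (auto simp: z_def ge_one_powr_ge_zero)
      \<comment> \<open>This product equals \<open>(y + 1 / y) - (z + 1 / z)\<close>.\<close>
      have "0 \<le> (y - z) * (1 - 1 / (y * z))"
        using y z mult_mono[of 1 y 1 z] by (intro mult_nonneg_nonneg) auto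
      then show ?thesis
        using y z by (simp add: z_def[symmetric] field_simps)
    qed
    finally have "y powr (p - 1) + y powr (- p - 1) \<le> 1 + 1 / y\<^sup>2"
      using y by (simp add: divide_right_mono add_divide_distrib power2_eq_square)
    then show "0 \<le> p * (1 + 1 / y\<^sup>2) - (p * y powr (p - 1) + p * y powr (- p - 1))"
      using assms by (simp add: distrib_left[symmetric])
  qed
  then show ?thesis by (simp add: h_def)
qed

lemma measure_circle [simp]: "measure circle (space circle) = 2 * pi"
  by (simp add: circle_def measure_restrict_space space_restrict_space)

text \<open>These moments settle the case \<open>U = V\<close> below, in which \<open>q\<close> is
  constant. Each integrand minus its mean has a periodic primitive.\<close>

lemma integral_circle_trig:
  "(\<integral>t. (cos (t + a))\<^sup>2 \<partial>circle) = pi"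
  "(\<integral>t. (sin (t + a))\<^sup>2 \<partial>circle) = pi"
  "(\<integral>t. (cos (t + a))\<^sup>2 * (sin (t + a))\<^sup>2 \<partial>circle) = pi / 4"
proof -
  have *: "(\<integral>t. (f t - c) \<partial>circle) = (\<integral>t. f t \<partial>circle) - 2 * pi * c"
    if "continuous_on UNIV f" for f :: "real \<Rightarrow> real" and c
    using that integrable_circle by simp
  have per: "cos (a + pi * 2) = cos a" "sin (a + pi * 2) = sin a"
    by (simp_all add: cos_add sin_add mult.commute)
  have sc: "(sin x)\<^sup>2 = 1 - (cos x)\<^sup>2" for x :: real
    by (simp add: sin_squared_eq)
  have "(\<integral>t. (cos (t + a))\<^sup>2 - 1/2 \<partial>circle) = 0"
    by (rule integral_circle_deriv[where F = "\<lambda>t. sin (t + a) * cos (t + a) / 2"])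
      (auto intro!: derivative_eq_intros continuous_intros
        simp: per sc power2_eq_square[symmetric] field_simps)
  then show 1: "(\<integral>t. (cos (t + a))\<^sup>2 \<partial>circle) = pi"
    by (subst (asm) *) (auto intro!: continuous_intros)
  have "(\<integral>t. (sin (t + a))\<^sup>2 - 1/2 \<partial>circle) = 0"
    by (rule integral_circle_deriv[where F = "\<lambda>t. - (sin (t + a) * cos (t + a) / 2)"])
      (auto intro!: derivative_eq_intros continuous_intros
        simp: per sc power2_eq_square[symmetric] field_simps)
  then show "(\<integral>t. (sin (t + a))\<^sup>2 \<partial>circle) = pi"
    by (subst (asm) *) (auto intro!: continuous_intros)
  have "(\<integral>t. (cos (t + a))\<^sup>2 * (sin (t + a))\<^sup>2 - 1/8 \<partial>circle) = 0"
  proof (rule integral_circle_deriv[where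
        F = "\<lambda>t. - (sin (t + a) * cos (t + a) * ((cos (t + a))\<^sup>2 - (sin (t + a))\<^sup>2) / 8)"])
    show "((\<lambda>t. - (sin (t + a) * cos (t + a) * ((cos (t + a))\<^sup>2 - (sin (t + a))\<^sup>2) / 8))
      has_real_derivative (cos (t + a))\<^sup>2 * (sin (t + a))\<^sup>2 - 1/8) (at t)" for t
    proof -
      define c s where "c = cos (t + a)" and "s = sin (t + a)"
      have sq: "s * s = 1 - c * c"
        using sc[of "t + a"] by (simp add: c_def s_def power2_eq_square)
      have sq2: "s * (s * x) = x - c * (c * x)" for x
        using arg_cong[OF sq, of "\<lambda>z. z * x"] by (simp add: algebra_simps)
      show ?thesis
        by (auto intro!: derivative_eq_intros simp: c_def[symmetric] s_def[symmetric])
          (simp add: power2_eq_square algebra_simps sq sq2, simp add: field_simps)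
    qed
  qed (auto intro!: continuous_intros simp: cos_add sin_add)
  then show "(\<integral>t. (cos (t + a))\<^sup>2 * (sin (t + a))\<^sup>2 \<partial>circle) = pi / 4"
    by (subst (asm) *) (auto intro!: continuous_intros)
qed

text \<open>The two identities combine to \<open>(U\<^sup>2 - V\<^sup>2) * (P1 * P2 - (2 - p) * (S *
  W)) = (U * P1)\<^sup>2 - (V * P2)\<^sup>2\<close>. For \<open>U > V\<close> the last two claims
  therefore say that the right-hand side lies between 0 and
  \<open>p * (U\<^sup>2 - V\<^sup>2) * (P1 * P2)\<close>. Everything reduces to locating the ratio
  \<open>U * P1 / (V * P2)\<close> between 1 and \<open>(U / V) powr p\<close>.\<close>

lemma circle_inequalities:
  fixes U V a p :: real
  assumes UV: "V \<le> U" "0 < V" and p: "0 < p" "p < 1"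
  defines "q \<equiv> \<lambda>t. U\<^sup>2 * (cos (t + a))\<^sup>2 + V\<^sup>2 * (sin (t + a))\<^sup>2"
  defines "S \<equiv> \<integral>t. q t powr (p / 2) \<partial>circle"
  defines "P1 \<equiv> \<integral>t. (cos (t + a))\<^sup>2 * q t powr (p / 2 - 1) \<partial>circle"
  defines "P2 \<equiv> \<integral>t. (sin (t + a))\<^sup>2 * q t powr (p / 2 - 1) \<partial>circle"
  defines "W \<equiv> \<integral>t. (cos (t + a))\<^sup>2 * (sin (t + a))\<^sup>2 * q t powr (p / 2 - 2) \<partial>circle"
  shows "P1 > 0" "P2 > 0" "(2 - p) * (U\<^sup>2 - V\<^sup>2) * W = P2 - P1" "S = U\<^sup>2 * P1 + V\<^sup>2 * P2"
    "(1 - p) * (P1 * P2) \<le> (2 - p) * (S * W)" "(2 - p) * (S * W) \<le> P1 * P2"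
proof -
  have U: "0 < U" using UV by simp
  define c s where "c = (\<lambda>t. cos (t + a))" and "s = (\<lambda>t. sin (t + a))"
  have q: "q = (\<lambda>t. U\<^sup>2 * (c t)\<^sup>2 + V\<^sup>2 * (s t)\<^sup>2)" by (simp add: q_def c_def s_def)
  have cs: "(c t)\<^sup>2 + (s t)\<^sup>2 = 1" for t by (simp add: c_def s_def)
  have VU2: "V\<^sup>2 \<le> U\<^sup>2" using UV by (simp add: power_mono)
  have qU: "q t \<le> U\<^sup>2" and qV: "V\<^sup>2 \<le> q t" for t
  proof -
    have "q t = U\<^sup>2 - (U\<^sup>2 - V\<^sup>2) * (s t)\<^sup>2"
      using cs[of t] unfolding q by algebra
    then show "q t \<le> U\<^sup>2" using VU2 by simp
    have "q t = V\<^sup>2 + (U\<^sup>2 - V\<^sup>2) * (c t)\<^sup>2"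
      using cs[of t] unfolding q by algebra
    then show "V\<^sup>2 \<le> q t" using VU2 by simp
  qed
  have qpos: "0 < q t" for t
    using qV[of t] UV by (smt (verit) zero_less_power)
  have [continuous_intros]: "continuous_on UNIV c" "continuous_on UNIV s" "continuous_on UNIV q"
    by (auto simp: q_def c_def s_def intro!: continuous_intros)
  have qpowr [continuous_intros]: "continuous_on UNIV (\<lambda>t. q t powr r)" for r
    using qpos by (intro continuous_on_powr continuous_intros) (metis less_irrefl)
  note int = integrable_circle
  have dc: "(c has_real_derivative - s t) (at t)" and ds: "(s has_real_derivative c t) (at t)" for t
    by (auto simp: c_def s_def intro!: derivative_eq_intros)
  have per: "c (2 * pi) = c 0" "s (2 * pi) = s 0"
    by (simp_all add: c_def s_def add.commute)
  have q_per: "q (2 * pi) = q 0" by (simp add: q per)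
  have dq: "(q has_real_derivative - (2 * (U\<^sup>2 - V\<^sup>2) * c t * s t)) (at t)" for t
    unfolding q by (auto intro!: derivative_eq_intros dc ds simp: algebra_simps)
  have P1: "P1 = (\<integral>t. (c t)\<^sup>2 * q t powr (p / 2 - 1) \<partial>circle)"
    and P2: "P2 = (\<integral>t. (s t)\<^sup>2 * q t powr (p / 2 - 1) \<partial>circle)"
    and W: "W = (\<integral>t. (c t)\<^sup>2 * (s t)\<^sup>2 * q t powr (p / 2 - 2) \<partial>circle)"
    by (simp_all add: P1_def P2_def W_def c_def s_def)
  have iP1: "integrable circle (\<lambda>t. (c t)\<^sup>2 * q t powr (p / 2 - 1))"
    and iP2: "integrable circle (\<lambda>t. (s t)\<^sup>2 * q t powr (p / 2 - 1))"
    and iW: "integrable circle (\<lambda>t. (c t)\<^sup>2 * (s t)\<^sup>2 * q t powr (p / 2 - 2))"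
    and iS: "integrable circle (\<lambda>t. q t powr (p / 2))"
    and iC: "integrable circle (\<lambda>t. (c t)\<^sup>2 / q t)"
    and iD: "integrable circle (\<lambda>t. (s t)\<^sup>2 / q t)"
    using qpos by (auto intro!: int continuous_intros) (metis less_irrefl)+
  have qsucc: "q t powr (r + 1) = q t powr r * q t" for t r
    using qpos[of t] by (simp add: powr_add)
  show S_eq: "S = U\<^sup>2 * P1 + V\<^sup>2 * P2"
  proof -
    have "q t powr (p / 2) = U\<^sup>2 * ((c t)\<^sup>2 * q t powr (p / 2 - 1)) + V\<^sup>2 * ((s t)\<^sup>2 * q t powr (p / 2 - 1))" for t
    proof -
      have "q t powr (p / 2) = q t powr (p / 2 - 1) * q t" using qsucc[of t "p / 2 - 1"] by simp
      also have "\<dots> = q t powr (p / 2 - 1) * (U\<^sup>2 * (c t)\<^sup>2 + V\<^sup>2 * (s t)\<^sup>2)" by (simp add: q)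
      finally show ?thesis by (simp add: algebra_simps)
    qed
    then show ?thesis unfolding S_def P1 P2 using iP1 iP2 by simp
  qed
  show D_eq: "(2 - p) * (U\<^sup>2 - V\<^sup>2) * W = P2 - P1"
  proof -
    \<comment> \<open>Integration by parts: differentiating \<open>q\<close> inside the primitive
      produces the factor \<open>(2 - p) * (U\<^sup>2 - V\<^sup>2)\<close> and lowers the exponent
      to that of \<open>W\<close>.\<close>
    have "(\<integral>t. ((c t)\<^sup>2 * q t powr (p / 2 - 1) - (s t)\<^sup>2 * q t powr (p / 2 - 1))
      + (2 - p) * (U\<^sup>2 - V\<^sup>2) * ((c t)\<^sup>2 * (s t)\<^sup>2 * q t powr (p / 2 - 2)) \<partial>circle) = 0"
    proof (rule integral_circle_deriv[where F = "\<lambda>t. s t * c t * q t powr (p / 2 - 1)"])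
      show "((\<lambda>t. s t * c t * q t powr (p / 2 - 1)) has_real_derivative
        ((c t)\<^sup>2 * q t powr (p / 2 - 1) - (s t)\<^sup>2 * q t powr (p / 2 - 1))
          + (2 - p) * (U\<^sup>2 - V\<^sup>2) * ((c t)\<^sup>2 * (s t)\<^sup>2 * q t powr (p / 2 - 2))) (at t)" for t
        using qpos[of t]
        by (auto intro!: derivative_eq_intros dc ds dq) (simp add: power2_eq_square algebra_simps)
    qed (auto intro!: continuous_intros simp: per q_per)
    then show ?thesis using iP1 iP2 iW by (simp add: P1 P2 W)
  qed
  \<comment> \<open>The case \<open>p = 0\<close>, in which \<open>lower\<close> and \<open>upper\<close> below are both equalities.\<close>
  have CD: "U * (\<integral>t. (c t)\<^sup>2 / q t \<partial>circle) = V * (\<integral>t. (s t)\<^sup>2 / q t \<partial>circle)"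
  proof (cases "U = V")
    case True
    then have "q t = U\<^sup>2" for t using cs[of t] by (simp add: q flip: distrib_left)
    then show ?thesis
      using integral_circle_trig[of a] by (simp add: c_def s_def True)
  next
    case False
    \<comment> \<open>The primitive below is the angle between the vectors
      \<open>(U * c t, V * s t)\<close> and \<open>(c t, s t)\<close>. Their inner product is
      \<open>l t\<close> and their cross product has size \<open>(U - V) * (s t * c t)\<close>,
      whence \<open>key\<close>. Since \<open>l\<close> stays positive, the arctangent never jumps,
      and the angle is periodic.\<close>
    define l where "l = (\<lambda>t. U * (c t)\<^sup>2 + V * (s t)\<^sup>2)"
    have lpos: "l t > 0" for t
    proof -
      have "l t = V + (U - V) * (c t)\<^sup>2" using cs[of t] unfolding l_def by algebra
      then show ?thesis using UV by (simp add: add_pos_nonneg)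
    qed
    have dl: "(l has_real_derivative - (2 * (U - V) * c t * s t)) (at t)" for t
      unfolding l_def by (auto intro!: derivative_eq_intros dc ds simp: algebra_simps)
    have "(\<integral>t. (U - V) * (U * ((c t)\<^sup>2 / q t) - V * ((s t)\<^sup>2 / q t)) \<partial>circle) = 0"
    proof (rule integral_circle_deriv[where F = "\<lambda>t. arctan ((U - V) * (s t * c t) / l t)"])
      fix t
      let ?N = "(U - V) * (s t * c t)"
      have c2: "(c t)\<^sup>2 = 1 - (s t)\<^sup>2" using cs[of t] by simp
      have key: "(l t)\<^sup>2 + ?N\<^sup>2 = q t"
        using c2 unfolding l_def q by algebra
      have num: "(U - V) * ((c t)\<^sup>2 - (s t)\<^sup>2) * l t + 2 * (U - V)\<^sup>2 * (c t)\<^sup>2 * (s t)\<^sup>2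
          = (U - V) * (U * (c t)\<^sup>2 - V * (s t)\<^sup>2)"
        using c2 unfolding l_def by algebra
      have "((\<lambda>t. arctan ((U - V) * (s t * c t) / l t)) has_real_derivative
        (((U - V) * ((c t)\<^sup>2 - (s t)\<^sup>2)) * l t - ?N * (- (2 * (U - V) * c t * s t))) / (l t * l t)
          * inverse (1 + (?N / l t)\<^sup>2)) (at t)"
        using lpos[of t]
        by (auto intro!: derivative_eq_intros dc ds dl simp: power2_eq_square algebra_simps)
      also have "(((U - V) * ((c t)\<^sup>2 - (s t)\<^sup>2)) * l t - ?N * (- (2 * (U - V) * c t * s t))) / (l t * l t)
          * inverse (1 + (?N / l t)\<^sup>2) = (U - V) * (U * (c t)\<^sup>2 - V * (s t)\<^sup>2) / q t"
      proof -
        have "1 + (?N / l t)\<^sup>2 = q t / (l t)\<^sup>2"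
          using lpos[of t] by (simp add: key[symmetric] power_divide field_simps)
        moreover have "((U - V) * ((c t)\<^sup>2 - (s t)\<^sup>2)) * l t - ?N * (- (2 * (U - V) * c t * s t))
          = (U - V) * (U * (c t)\<^sup>2 - V * (s t)\<^sup>2)"
          by (subst num[symmetric]) (simp add: power2_eq_square algebra_simps)
        ultimately show ?thesis
          using lpos[of t] qpos[of t] by (simp add: power2_eq_square)
      qed
      finally show "((\<lambda>t. arctan ((U - V) * (s t * c t) / l t)) has_real_derivative
          (U - V) * (U * ((c t)\<^sup>2 / q t) - V * ((s t)\<^sup>2 / q t))) (at t)"
        by (simp add: diff_divide_distrib right_diff_distrib)
    next
      show "continuous_on UNIV (\<lambda>t. (U - V) * (U * ((c t)\<^sup>2 / q t) - V * ((s t)\<^sup>2 / q t)))"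
        using qpos by (intro continuous_intros) (metis less_irrefl)+
    qed (simp add: l_def per)
    then show ?thesis using iC iD False by (simp del: times_divide_eq_right)
  qed
  have powr_sq: "(x\<^sup>2) powr (p / 2) = x powr p" if "0 < x" for x
    using that by (simp add: powr_powr flip: powr_numeral)
  have P1_le: "P1 \<le> U powr p * (\<integral>t. (c t)\<^sup>2 / q t \<partial>circle)"
  proof -
    have "(c t)\<^sup>2 * q t powr (p / 2 - 1) \<le> U powr p * ((c t)\<^sup>2 / q t)" for t
    proof -
      have "q t powr (p / 2) \<le> U powr p"
        using powr_mono2[of "p / 2" "q t" "U\<^sup>2"] p qU[of t] qpos[of t] powr_sq[OF U] by simp
      then have "(c t)\<^sup>2 * (q t powr (p / 2) / q t) \<le> (c t)\<^sup>2 * (U powr p / q t)"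
        using qpos[of t] by (intro mult_left_mono divide_right_mono) auto
      then show ?thesis using qpos[of t] by (simp add: powr_diff mult.commute)
    qed
    then have "P1 \<le> (\<integral>t. U powr p * ((c t)\<^sup>2 / q t) \<partial>circle)"
      unfolding P1 using iP1 iC by (intro integral_mono integrable_mult_right) auto
    then show ?thesis by (simp del: times_divide_eq_right)
  qed
  have P2_ge: "V powr p * (\<integral>t. (s t)\<^sup>2 / q t \<partial>circle) \<le> P2"
  proof -
    have "V powr p * ((s t)\<^sup>2 / q t) \<le> (s t)\<^sup>2 * q t powr (p / 2 - 1)" for t
    proof -
      have "V powr p \<le> q t powr (p / 2)"
        using powr_mono2[of "p / 2" "V\<^sup>2" "q t"] p qV[of t] powr_sq[OF UV(2)] by simp
      then have "(s t)\<^sup>2 * (V powr p / q t) \<le> (s t)\<^sup>2 * (q t powr (p / 2) / q t)"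
        using qpos[of t] by (intro mult_left_mono divide_right_mono) auto
      then show ?thesis using qpos[of t] by (simp add: powr_diff mult.commute)
    qed
    then have "(\<integral>t. V powr p * ((s t)\<^sup>2 / q t) \<partial>circle) \<le> P2"
      unfolding P2 using iP2 iD by (intro integral_mono integrable_mult_right) auto
    then show ?thesis by (simp del: times_divide_eq_right)
  qed
  \<comment> \<open>The identity \<open>CD\<close> after replacing \<open>q powr (p / 2)\<close> by
    its maximum \<open>U powr p\<close> in \<open>P1\<close> and by its minimum
    \<open>V powr p\<close> in \<open>P2\<close>.\<close>
  have lower: "U * P1 * V powr p \<le> V * P2 * U powr p"
  proof -
    have "U * P1 * V powr p \<le> U * (U powr p * (\<integral>t. (c t)\<^sup>2 / q t \<partial>circle)) * V powr p"
      using P1_le U by (intro mult_right_mono mult_left_mono) auto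
    also have "\<dots> = V * (V powr p * (\<integral>t. (s t)\<^sup>2 / q t \<partial>circle)) * U powr p"
      using CD by (simp add: mult_ac)
    also have "\<dots> \<le> V * P2 * U powr p"
      using P2_ge UV by (intro mult_right_mono mult_left_mono) auto
    finally show ?thesis .
  qed
  \<comment> \<open>The factor \<open>U * (c t)\<^sup>2 - V * (s t)\<^sup>2\<close> has integral
    zero against \<open>1 / q\<close>, by \<open>CD\<close>. As \<open>q - U * V\<close> is a
    nonnegative multiple of it, the increasing weight \<open>q powr (p / 2)\<close> can only raise
    the integral above what the constant \<open>(U * V) powr (p / 2)\<close> gives, namely
    zero.\<close>
  have upper: "V * P2 \<le> U * P1"
  proof -
    have "(U * V) powr (p / 2) * (U * ((c t)\<^sup>2 / q t) - V * ((s t)\<^sup>2 / q t))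
      \<le> U * ((c t)\<^sup>2 * q t powr (p / 2 - 1)) - V * ((s t)\<^sup>2 * q t powr (p / 2 - 1))" for t
    proof -
      let ?k = "U * (c t)\<^sup>2 - V * (s t)\<^sup>2"
      have k: "q t - U * V = (U - V) * ?k"
        using cs[of t] unfolding q by algebra
      have "0 \<le> ?k * (q t powr (p / 2) - (U * V) powr (p / 2))"
      proof (cases "0 \<le> ?k")
        case True
        then have "U * V \<le> q t" using k UV by (metis diff_ge_0_iff_ge mult_nonneg_nonneg)
        then have "(U * V) powr (p / 2) \<le> q t powr (p / 2)"
          using p U UV by (intro powr_mono2) auto
        with True show ?thesis by simp
      next
        case False
        then have "q t - U * V \<le> 0" unfolding k using UV by (intro mult_nonneg_nonpos) auto
        then have "q t powr (p / 2) \<le> (U * V) powr (p / 2)"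
          using p qpos[of t] by (intro powr_mono2) auto
        with False show ?thesis by (intro mult_nonpos_nonpos) auto
      qed
      then have "0 \<le> ?k * (q t powr (p / 2) - (U * V) powr (p / 2)) / q t"
        using qpos[of t] by simp
      then show ?thesis
        by (simp add: powr_diff qpos less_imp_le algebra_simps diff_divide_distrib add_divide_distrib)
    qed
    then have "(\<integral>t. (U * V) powr (p / 2) * (U * ((c t)\<^sup>2 / q t) - V * ((s t)\<^sup>2 / q t)) \<partial>circle)
      \<le> (\<integral>t. U * ((c t)\<^sup>2 * q t powr (p / 2 - 1)) - V * ((s t)\<^sup>2 * q t powr (p / 2 - 1)) \<partial>circle)"
      using iP1 iP2 iC iD
      by (intro integral_mono integrable_mult_right Bochner_Integration.integrable_diff) auto
    then show ?thesis using iP1 iP2 iC iD CD by (simp add: P1 P2 del: times_divide_eq_right)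
  qed
  have Spos: "0 < S"
  proof -
    have "(\<integral>t. V powr p \<partial>circle) \<le> S"
      unfolding S_def
      using iS powr_mono2[of "p / 2" "V\<^sup>2" "q _"] p qV powr_sq[OF UV(2)]
      by (intro integral_mono) auto
    moreover have "0 < (\<integral>t. V powr p \<partial>circle)"
      using UV by simp
    ultimately show ?thesis by simp
  qed
  have nn: "0 \<le> P1" "0 \<le> P2"
    unfolding P1 P2 by (auto intro!: integral_nonneg_AE)
  show P2pos: "0 < P2"
  proof (rule ccontr)
    assume "\<not> 0 < P2"
    then have "P2 = 0" using nn by simp
    then have "U * P1 * V powr p \<le> 0" using lower by simp
    then have "P1 \<le> 0" using U UV by (simp add: mult_le_0_iff zero_less_mult_iff not_less)
    then show False using \<open>P2 = 0\<close> nn Spos S_eq by simp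
  qed
  show P1pos: "0 < P1"
    using upper P2pos U UV by (smt (verit) mult_pos_pos zero_less_mult_iff)
  have bounds: "(1 - p) * (P1 * P2) \<le> (2 - p) * (S * W) \<and> (2 - p) * (S * W) \<le> P1 * P2"
  proof (cases "U = V")
    case True
    then have q': "q t = U\<^sup>2" for t using cs[of t] by (simp add: q flip: distrib_left)
    define Q where "Q = U\<^sup>2"
    have Q: "Q > 0" using U by (simp add: Q_def)
    have eq: "S = 2 * pi * Q powr (p / 2)" "P1 = pi * Q powr (p / 2 - 1)" "P2 = pi * Q powr (p / 2 - 1)"
      "W = pi / 4 * Q powr (p / 2 - 2)"
      using integral_circle_trig[of a]
      unfolding S_def P1 P2 W by (simp_all add: q' Q_def[symmetric] c_def s_def)
    have "Q powr (p / 2) * Q powr (p / 2 - 2) = Q powr (p / 2 - 1) * Q powr (p / 2 - 1)"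
      by (simp flip: powr_add)
    \<comment> \<open>With constant \<open>q\<close> both bounds become
      \<open>1 - p \<le> 1 - p / 2 \<le> 1\<close>.\<close>
    then have "S * W = (1 / 2) * (P1 * P2)" by (simp add: eq)
    then have "(2 - p) * (S * W) = (1 - p / 2) * (P1 * P2)" by (simp add: algebra_simps)
    then show ?thesis using p P1pos P2pos by (auto intro!: mult_right_mono)
  next
    case False
    then have d: "0 < U\<^sup>2 - V\<^sup>2" using UV by (simp add: power_strict_mono)
    have "(U\<^sup>2 - V\<^sup>2) * ((2 - p) * (S * W)) = S * (P2 - P1)"
      unfolding D_eq[symmetric] by (simp add: algebra_simps)
    also have "\<dots> = (U\<^sup>2 - V\<^sup>2) * (P1 * P2) - ((U * P1)\<^sup>2 - (V * P2)\<^sup>2)"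
      unfolding S_eq by (simp add: power2_eq_square algebra_simps)
    finally have eq: "(U\<^sup>2 - V\<^sup>2) * ((2 - p) * (S * W))
      = (U\<^sup>2 - V\<^sup>2) * (P1 * P2) - ((U * P1)\<^sup>2 - (V * P2)\<^sup>2)" .
    have le: "(U * P1)\<^sup>2 - (V * P2)\<^sup>2 \<le> p * ((U\<^sup>2 - V\<^sup>2) * (P1 * P2))"
    proof -
      \<comment> \<open>Divided by \<open>(U * P1) * (V * P2)\<close>, the claim is
        \<open>z - 1 / z \<le> p * (r - 1 / r)\<close>. It follows from
        \<open>z \<le> r powr p\<close>, the content of \<open>lower\<close>, and
        \<open>powr_diff_inverse_le\<close>.\<close>
      define z r where "z = U * P1 / (V * P2)" and "r = U / V"
      have VP: "0 < V * P2" and UP: "0 < U * P1" using UV U P1pos P2pos by auto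
      have z1: "1 \<le> z" using upper VP by (simp add: z_def)
      have r1: "1 \<le> r" using UV by (simp add: r_def)
      have zr: "z \<le> r powr p"
        using lower VP UV U by (simp add: z_def r_def powr_divide divide_simps mult_ac)
      have "z - 1 / z \<le> r powr p - 1 / r powr p"
        using z1 zr by (intro diff_mono) (auto simp: divide_simps)
      also have "\<dots> \<le> p * (r - 1 / r)"
        using powr_diff_inverse_le[of p r] p r1 by (simp add: powr_minus_divide)
      finally have "(z - 1 / z) * ((U * P1) * (V * P2)) \<le> p * (r - 1 / r) * ((U * P1) * (V * P2))"
        using UP VP by (intro mult_right_mono) auto
      moreover have "(z - 1 / z) * ((U * P1) * (V * P2)) = (U * P1)\<^sup>2 - (V * P2)\<^sup>2"
        using UV U P1pos P2pos by (simp add: z_def field_simps power2_eq_square)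
      moreover have "(r - 1 / r) * ((U * P1) * (V * P2)) = (U\<^sup>2 - V\<^sup>2) * (P1 * P2)"
        using UV U by (simp add: r_def field_simps power2_eq_square)
      ultimately show ?thesis by (simp only: mult.assoc)
    qed
    have "(V * P2)\<^sup>2 \<le> (U * P1)\<^sup>2"
      using upper UV P2pos by (intro power_mono) auto
    then have "(U\<^sup>2 - V\<^sup>2) * ((2 - p) * (S * W)) \<le> (U\<^sup>2 - V\<^sup>2) * (P1 * P2)"
      using eq by simp
    moreover have "(U\<^sup>2 - V\<^sup>2) * ((1 - p) * (P1 * P2)) \<le> (U\<^sup>2 - V\<^sup>2) * ((2 - p) * (S * W))"
      using eq le by (simp add: algebra_simps)
    ultimately show ?thesis using d by simp
  qed
  show "(1 - p) * (P1 * P2) \<le> (2 - p) * (S * W)" "(2 - p) * (S * W) \<le> P1 * P2"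
    using bounds by auto
qed

subsection \<open>Orthonormal eigenbases and a quadratic form\<close>

text \<open>Evaluate at the minimiser \<open>B / A\<close>; if \<open>A = 0\<close>, an affine
  function bounded below on the whole line is constant. A quadratic inequality is thereby recovered
  from a family, indexed by \<open>l\<close>, of inequalities linear in the coefficients.\<close>

lemma discriminant_le:
  fixes A B C :: real
  assumes "0 \<le> A" "\<And>l. 0 \<le> A * l\<^sup>2 - 2 * B * l + C"
  shows "B\<^sup>2 \<le> A * C"
proof (cases "A = 0")
  case False
  with assms(1) have "A > 0" by simp
  have "0 \<le> A * (A * (B / A)\<^sup>2 - 2 * B * (B / A) + C)"
    using assms(2)[of "B / A"] \<open>A > 0\<close> by (intro mult_nonneg_nonneg) auto
  then show ?thesis using \<open>A > 0\<close> by (simp add: field_simps power2_eq_square)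
next
  case True
  have "B = 0"
  proof (rule ccontr)
    assume "B \<noteq> 0"
    then obtain l where "B * l = \<bar>C\<bar> + 1"
      by (metis nonzero_mult_div_cancel_left times_divide_eq_right)
    then show False
      using assms(2)[of l] True by simp
  qed
  then show ?thesis using True by simp
qed

text \<open>Take an orthonormal set of eigenvectors of largest size. If it does not span, its
  orthogonal complement \<open>S\<close> is \<open>T\<close>-invariant, and a maximiser of
  \<open>x \<bullet> T x\<close> on the unit sphere of \<open>S\<close> is one more
  eigenvector.\<close>

lemma orthonormal_eigenbasis:
  fixes T :: "'a::euclidean_space \<Rightarrow> 'a"
  assumes lin: "linear T" and sym: "\<And>x y. T x \<bullet> y = x \<bullet> T y"
  obtains V where "finite V" "pairwise orthogonal V" "\<And>v. v \<in> V \<Longrightarrow> norm v = 1" "span V = UNIV"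
    "\<And>v. v \<in> V \<Longrightarrow> \<exists>c. T v = c *\<^sub>R v"
proof -
  define Q where "Q V \<longleftrightarrow> pairwise orthogonal V \<and> (\<forall>v\<in>V. norm v = 1 \<and> (\<exists>c. T v = c *\<^sub>R v))"
    for V :: "'a set"
  have indep: "independent V" if "Q V" for V
    using that by (intro pairwise_orthogonal_independent) (auto simp: Q_def)
  have "\<exists>V. Q V \<and> (\<forall>V'. Q V' \<longrightarrow> card V' \<le> card V)"
  proof (rule ex_has_greatest_nat)
    show "Q {}" by (simp add: Q_def)
    show "\<forall>V. Q V \<longrightarrow> card V < Suc DIM('a)"
      using independent_bound indep by (meson le_imp_less_Suc)
  qed
  then obtain V where V: "Q V" and max: "\<And>V'. Q V' \<Longrightarrow> card V' \<le> card V"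
    by blast
  have fin: "finite V" using independent_bound indep[OF V] by blast
  have "span V = UNIV"
  proof (rule ccontr)
    assume "span V \<noteq> UNIV"
    then obtain a where a: "a \<noteq> 0" "\<And>x. x \<in> span V \<Longrightarrow> a \<bullet> x = 0"
      using span_not_UNIV_orthogonal by metis
    define S where "S = {x. \<forall>v\<in>V. v \<bullet> x = 0}"
    have S_add: "x + y \<in> S" and S_scale: "c *\<^sub>R x \<in> S" and S_diff: "x - y \<in> S"
      if "x \<in> S" "y \<in> S" for x y c
      using that by (auto simp: S_def inner_add_right inner_diff_right)
    have S_T: "T x \<in> S" if "x \<in> S" for x
      unfolding S_def
    proof safe
      fix v assume "v \<in> V"
      then obtain c where "T v = c *\<^sub>R v" using V by (auto simp: Q_def)
      then show "v \<bullet> T x = 0" using that \<open>v \<in> V\<close> by (simp add: S_def flip: sym)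
    qed
    have "closed S"
      unfolding S_def Collect_ball_eq by (intro closed_INT ballI closed_hyperplane)
    then have "compact (S \<inter> sphere 0 1)"
      by (simp add: compact_Int closed_Int_compact)
    moreover have "a \<in> S"
      using a by (auto simp: S_def span_base inner_commute)
    then have "a /\<^sub>R norm a \<in> S \<inter> sphere 0 1"
      using a(1) S_scale by auto
    then have "S \<inter> sphere 0 1 \<noteq> {}" by blast
    moreover have "continuous_on (S \<inter> sphere 0 1) (\<lambda>x. x \<bullet> T x)"
      by (intro continuous_intros linear_continuous_on) (simp add: lin flip: linear_conv_bounded_linear)
    ultimately obtain e where "e \<in> S \<inter> sphere 0 1" "\<forall>x \<in> S \<inter> sphere 0 1. x \<bullet> T x \<le> e \<bullet> T e"
      using continuous_attains_sup[of "S \<inter> sphere 0 1" "\<lambda>x. x \<bullet> T x"] by blast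
    then have e: "e \<in> S" "norm e = 1"
      and e_max: "\<And>x. x \<in> S \<Longrightarrow> norm x = 1 \<Longrightarrow> x \<bullet> T x \<le> e \<bullet> T e"
      by auto
    define c where "c = e \<bullet> T e"
    have ray: "z \<bullet> T z \<le> c * (z \<bullet> z)" if "z \<in> S" for z
    proof (cases "z = 0")
      case False
      have "(z /\<^sub>R norm z) \<bullet> T (z /\<^sub>R norm z) \<le> c"
        unfolding c_def using that False S_scale by (intro e_max) auto
      then have "(z \<bullet> T z) / (norm z)\<^sup>2 \<le> c"
        by (simp add: linear_scale[OF lin] power2_eq_square divide_inverse mult_ac)
      then show ?thesis using False by (simp add: divide_le_eq power2_norm_eq_inner)
    qed (simp add: linear_0[OF lin])
    \<comment> \<open>First-order condition at the maximiser: by \<open>ray\<close>, a quadratic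
      polynomial in \<open>l\<close> without constant term is nonnegative, so its linear coefficient
      vanishes.\<close>
    have ortho: "y \<bullet> (T e - c *\<^sub>R e) = 0" if "y \<in> S" for y
    proof -
      let ?b = "y \<bullet> (T e - c *\<^sub>R e)"
      have "0 \<le> (c * (y \<bullet> y) - y \<bullet> T y) * l\<^sup>2 - 2 * ?b * l + 0" for l
      proof -
        have "(e + l *\<^sub>R y) \<bullet> T (e + l *\<^sub>R y) \<le> c * ((e + l *\<^sub>R y) \<bullet> (e + l *\<^sub>R y))"
          using e that S_add S_scale by (intro ray) blast
        moreover have "e \<bullet> T y = y \<bullet> T e" using sym[of y e] by (simp add: inner_commute)
        moreover have "e \<bullet> e = 1" using e(2) by (simp add: norm_eq_1)
        ultimately show ?thesis
          by (simp add: linear_add[OF lin] linear_scale[OF lin] inner_add inner_diff_right c_def[symmetric]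
              inner_commute[of e y] power2_eq_square algebra_simps)
      qed
      then have "?b\<^sup>2 \<le> (c * (y \<bullet> y) - y \<bullet> T y) * 0"
        using ray[OF that] by (intro discriminant_le) auto
      then show ?thesis by simp
    qed
    \<comment> \<open>The residual lies in \<open>S\<close> and is orthogonal to all of
      \<open>S\<close>, hence to itself.\<close>
    have "T e - c *\<^sub>R e \<in> S" using e S_T S_diff S_scale by blast
    from ortho[OF this] have eig: "T e = c *\<^sub>R e" by simp
    have "e \<notin> V" using e by (auto simp: S_def)
    moreover have "Q (insert e V)"
      using V e eig by (auto simp: Q_def pairwise_insert orthogonal_def S_def inner_commute)
    ultimately show False using max[of "insert e V"] fin by simp
  qed
  then show ?thesis using that V fin unfolding Q_def by blast
qed

text \<open>The Hessian of \<open>F powr (1 / p)\<close> in the diagonal directions, where \<open>u\<close> are the squared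
  singular values; homogeneity (the two row sums) turns it into a sum over pairs.\<close>

lemma diagonal_form_nonneg:
  fixes u P d :: "'i \<Rightarrow> real" and W :: "'i \<Rightarrow> 'i \<Rightarrow> real"
  assumes sym: "\<And>a c. a \<in> V \<Longrightarrow> c \<in> V \<Longrightarrow> W a c = W c a"
    and row: "\<And>a. a \<in> V \<Longrightarrow> (\<Sum>c\<in>V. u c * W a c) = P a" and tot: "(\<Sum>a\<in>V. u a * P a) = F"
    and u: "\<And>a. a \<in> V \<Longrightarrow> 0 \<le> u a"
    and pair: "\<And>a c. a \<in> V \<Longrightarrow> c \<in> V \<Longrightarrow> a \<noteq> c \<Longrightarrow> (1 - p) * (P a * P c) \<le> (2 - p) * (F * W a c)"
  shows "0 \<le> F * ((\<Sum>a\<in>V. u a * P a * (d a)\<^sup>2) - (2 - p) * (\<Sum>a\<in>V. \<Sum>c\<in>V. u a * u c * d a * d c * W a c))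
    + (1 - p) * (\<Sum>a\<in>V. u a * d a * P a)\<^sup>2"
proof -
  define A where "A = (\<Sum>a\<in>V. u a * P a * (d a)\<^sup>2)"
  define X where "X = (\<Sum>a\<in>V. \<Sum>c\<in>V. u a * u c * d a * d c * W a c)"
  define B where "B = (\<Sum>a\<in>V. u a * d a * P a)"
  \<comment> \<open>This sum over ordered pairs is twice the form: the squares
    \<open>(d a)\<^sup>2\<close> and \<open>(d c)\<^sup>2\<close> each contribute
    \<open>F * A\<close> with weight \<open>(2 - p) - (1 - p) = 1\<close>, and the cross terms give
    \<open>X\<close> and \<open>B\<^sup>2\<close>.\<close>
  have "0 \<le> (\<Sum>a\<in>V. \<Sum>c\<in>V. u a * u c * (d a - d c)\<^sup>2 * ((2 - p) * (F * W a c) - (1 - p) * (P a * P c)))"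
  proof (intro sum_nonneg)
    fix a c assume "a \<in> V" "c \<in> V"
    then show "0 \<le> u a * u c * (d a - d c)\<^sup>2 * ((2 - p) * (F * W a c) - (1 - p) * (P a * P c))"
      using u pair by (cases "a = c") auto
  qed
  also have "\<dots> = (2 - p) * F * (\<Sum>a\<in>V. \<Sum>c\<in>V. u a * (d a)\<^sup>2 * (u c * W a c))
      + (2 - p) * F * (\<Sum>a\<in>V. \<Sum>c\<in>V. u c * (d c)\<^sup>2 * (u a * W a c))
      - 2 * (2 - p) * F * X
      - (1 - p) * (\<Sum>a\<in>V. \<Sum>c\<in>V. u a * P a * (d a)\<^sup>2 * (u c * P c))
      - (1 - p) * (\<Sum>a\<in>V. \<Sum>c\<in>V. u a * P a * (u c * P c * (d c)\<^sup>2))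
      + 2 * (1 - p) * (\<Sum>a\<in>V. \<Sum>c\<in>V. u a * d a * P a * (u c * d c * P c))"
    unfolding X_def by (simp add: sum_distrib_left power2_eq_square algebra_simps sum.distrib sum_subtractf)
  also have "(\<Sum>a\<in>V. \<Sum>c\<in>V. u a * (d a)\<^sup>2 * (u c * W a c)) = A"
    unfolding A_def by (intro sum.cong refl) (simp add: row flip: sum_distrib_left)
  also have "(\<Sum>a\<in>V. \<Sum>c\<in>V. u c * (d c)\<^sup>2 * (u a * W a c)) = A"
  proof -
    have "(\<Sum>a\<in>V. \<Sum>c\<in>V. u c * (d c)\<^sup>2 * (u a * W a c)) = (\<Sum>c\<in>V. \<Sum>a\<in>V. u c * (d c)\<^sup>2 * (u a * W c a))"
      by (subst sum.swap) (intro sum.cong refl, simp add: sym)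
    also have "\<dots> = A"
      unfolding A_def by (intro sum.cong refl) (simp add: row flip: sum_distrib_left)
    finally show ?thesis .
  qed
  also have "(\<Sum>a\<in>V. \<Sum>c\<in>V. u a * P a * (d a)\<^sup>2 * (u c * P c)) = A * F"
    by (simp add: A_def tot[symmetric] sum_product)
  also have "(\<Sum>a\<in>V. \<Sum>c\<in>V. u a * P a * (u c * P c * (d c)\<^sup>2)) = F * A"
    by (simp add: A_def tot[symmetric] sum_product)
  also have "(\<Sum>a\<in>V. \<Sum>c\<in>V. u a * d a * P a * (u c * d c * P c)) = B\<^sup>2"
    by (simp add: B_def power2_eq_square sum_product)
  finally have "0 \<le> 2 * (F * (A - (2 - p) * X) + (1 - p) * B\<^sup>2)"
    by (simp add: algebra_simps)
  then show ?thesis by (simp add: A_def X_def B_def)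
qed

subsection \<open>Rotational averages\<close>

text \<open>Written as the identity plus a correction inside the plane, so that no basis of the
  orthogonal complement has to be chosen. It is a rotation when \<open>v\<close> and
  \<open>w\<close> are orthonormal.\<close>

definition plane_rotation :: "'a::euclidean_space \<Rightarrow> 'a \<Rightarrow> real \<Rightarrow> 'a \<Rightarrow> 'a" where
  "plane_rotation v w t x =
     x + ((cos t - 1) * (x \<bullet> v) - sin t * (x \<bullet> w)) *\<^sub>R v
       + (sin t * (x \<bullet> v) + (cos t - 1) * (x \<bullet> w)) *\<^sub>R w"

lemma plane_rotation_inner:
  assumes "v \<bullet> v = 1" "w \<bullet> w = 1" "v \<bullet> w = 0"
  shows "plane_rotation v w t x \<bullet> v = cos t * (x \<bullet> v) - sin t * (x \<bullet> w)"
    and "plane_rotation v w t x \<bullet> w = sin t * (x \<bullet> v) + cos t * (x \<bullet> w)"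
    and "v \<bullet> y = 0 \<Longrightarrow> w \<bullet> y = 0 \<Longrightarrow> plane_rotation v w t x \<bullet> y = x \<bullet> y"
  using assms by (simp_all add: plane_rotation_def inner_add_left inner_commute[of w v] algebra_simps)

lemma orthogonal_plane_rotation:
  assumes "v \<bullet> v = 1" "w \<bullet> w = 1" "v \<bullet> w = 0"
  shows "orthogonal_transformation (plane_rotation v w t)"
  unfolding orthogonal_transformation_def
proof (intro conjI allI)
  show "linear (plane_rotation v w t)"
    by (rule linearI) (simp_all add: plane_rotation_def inner_add_left algebra_simps)
  fix x y
  have sc: "sin t * sin t = 1 - cos t * cos t"
    using sin_cos_squared_add[of t] by (simp add: power2_eq_square)
  have sc2: "sin t * (sin t * z) = z - cos t * (cos t * z)" for z
    using arg_cong[OF sc, of "\<lambda>s. s * z"] by (simp add: algebra_simps)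
  show "plane_rotation v w t x \<bullet> plane_rotation v w t y = x \<bullet> y"
    unfolding plane_rotation_def[of v w t x] inner_add_left inner_scaleR_left
    using assms
    by (simp add: inner_commute[of v "plane_rotation v w t y"]
          inner_commute[of w "plane_rotation v w t y"] plane_rotation_inner)
      (simp add: plane_rotation_def inner_add_right algebra_simps sc sc2)
qed

definition reflect :: "'a::euclidean_space \<Rightarrow> 'a \<Rightarrow> 'a" where
  "reflect v x = x - (2 * (x \<bullet> v)) *\<^sub>R v"

lemma orthogonal_reflect:
  assumes "v \<bullet> v = 1"
  shows "orthogonal_transformation (reflect v)"
  unfolding orthogonal_transformation_def
proof (intro conjI allI)
  show "linear (reflect v)"
    by (rule linearI) (simp_all add: reflect_def inner_add_left algebra_simps)
  show "reflect v x \<bullet> reflect v y = x \<bullet> y" for x y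
    using assms by (simp add: reflect_def inner_diff_left inner_diff_right inner_commute[of v y] algebra_simps)
qed

context invariant_sphere_measure
begin

lemma integral_odd:
  fixes h :: "'a \<Rightarrow> real"
  assumes T: "orthogonal_transformation T" and h: "continuous_on (sphere 0 1) h"
    and odd: "\<And>x. h (T x) = - h x"
  shows "(\<integral>x. h x \<partial>M) = 0"
  using integral_orthogonal[OF T h] by (simp add: odd)

text \<open>For each fixed angle the rotation preserves \<open>M\<close>; after exchanging the
  integrals the inner one no longer depends on \<open>t\<close>, and the factor is the mass of
  \<open>circle\<close>.\<close>

lemma integral_plane_rotation:
  fixes g :: "'a \<Rightarrow> real"
  assumes vw: "v \<bullet> v = 1" "w \<bullet> w = 1" "v \<bullet> w = 0" and g: "continuous_on (sphere 0 1) g"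
  shows "(\<integral>x. (\<integral>t. g (plane_rotation v w t x) \<partial>circle) \<partial>M) = 2 * pi * (\<integral>x. g x \<partial>M)" (is ?eq)
    and "x \<in> sphere 0 1 \<Longrightarrow> integrable circle (\<lambda>t. g (plane_rotation v w t x))"
proof -
  have cont: "continuous_on UNIV (\<lambda>(x, t). plane_rotation v w t x)"
    unfolding plane_rotation_def case_prod_unfold by (intro continuous_intros)
  have maps: "plane_rotation v w t x \<in> sphere 0 1" if "x \<in> sphere 0 1" for t x
    using that orthogonal_transformation_norm[OF orthogonal_plane_rotation[OF vw]] by simp
  have "continuous_on (sphere 0 1 \<times> {0..2*pi}) (g \<circ> (\<lambda>(x, t). plane_rotation v w t x))"
    by (rule continuous_on_compose[OF continuous_on_subset[OF cont] continuous_on_subset[OF g]])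
      (use maps in auto)
  then have gc: "continuous_on (sphere 0 1 \<times> {0..2*pi}) (\<lambda>(x, t). g (plane_rotation v w t x))"
    by (simp add: o_def case_prod_unfold)
  note swap = integral_swap_continuous[OF compact_measure_axioms compact_measure_circle gc]
  have "(\<integral>x. (\<integral>t. g (plane_rotation v w t x) \<partial>circle) \<partial>M) = (\<integral>t. (\<integral>x. g x \<partial>M) \<partial>circle)"
    unfolding swap[symmetric]
    by (simp add: integral_orthogonal[OF orthogonal_plane_rotation[OF vw] g])
  then show ?eq by simp
  assume x: "x \<in> sphere 0 1"
  have "continuous_on UNIV (g \<circ> (\<lambda>t. plane_rotation v w t x))"
    using maps[OF x] unfolding plane_rotation_def
    by (intro continuous_on_compose continuous_on_subset[OF g] continuous_intros) auto
  then show "integrable circle (\<lambda>t. g (plane_rotation v w t x))"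
    by (intro integrable_circle) (simp add: o_def)
qed

text \<open>Reduces an inequality that is linear in integrals over the sphere to the averages over
  single orbits of a plane rotation.\<close>

lemma integral_nonneg_by_rotation:
  fixes g :: "'a \<Rightarrow> real"
  assumes vw: "v \<bullet> v = 1" "w \<bullet> w = 1" "v \<bullet> w = 0" and g: "continuous_on (sphere 0 1) g"
    and nn: "\<And>x. x \<in> sphere 0 1 \<Longrightarrow> 0 \<le> (\<integral>t. g (plane_rotation v w t x) \<partial>circle)"
  shows "0 \<le> (\<integral>x. g x \<partial>M)"
proof -
  have "0 \<le> (\<integral>x. (\<integral>t. g (plane_rotation v w t x) \<partial>circle) \<partial>M)"
    by (rule integral_nonneg_AE, rule AE_I2) (use nn in \<open>auto simp: space_M\<close>)
  then show ?thesis
    unfolding integral_plane_rotation(1)[OF vw g] by (auto simp: zero_le_mult_iff dest: leD)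
qed

end

section \<open>Moments with respect to a basis of right singular vectors\<close>

locale singular_basis = invariant_sphere_measure M
  for M :: "'a::euclidean_space measure" +
  fixes f :: "'a \<Rightarrow> 'b::euclidean_space" and V :: "'a set" and p :: real
  assumes linear_f: "linear f" and inj_f: "f x = 0 \<Longrightarrow> x = 0"
    and finite_V: "finite V" and orthogonal_V: "pairwise orthogonal V"
    and norm_V: "v \<in> V \<Longrightarrow> norm v = 1" and span_V: "span V = UNIV"
    and orthogonal_fV: "v \<in> V \<Longrightarrow> w \<in> V \<Longrightarrow> v \<noteq> w \<Longrightarrow> f v \<bullet> f w = 0"
    and p: "0 < p" "p < 1"
begin

definition u :: "'a \<Rightarrow> real" where "u v = (norm (f v))\<^sup>2"
definition q :: "'a \<Rightarrow> real" where "q x = (norm (f x))\<^sup>2"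
definition F :: real where "F = (\<integral>x. q x powr (p / 2) \<partial>M)"
definition P :: "'a \<Rightarrow> real" where
  "P v = (\<integral>x. (x \<bullet> v)\<^sup>2 * q x powr (p / 2 - 1) \<partial>M)"
definition W :: "'a \<Rightarrow> 'a \<Rightarrow> real" where
  "W v w = (\<integral>x. (x \<bullet> v)\<^sup>2 * (x \<bullet> w)\<^sup>2 * q x powr (p / 2 - 2) \<partial>M)"

lemma inner_V: "v \<in> V \<Longrightarrow> w \<in> V \<Longrightarrow> v \<bullet> w = (if v = w then 1 else 0)"
  using orthogonal_V norm_V by (auto simp: pairwise_def orthogonal_def norm_eq_1)

lemma expand: "x = (\<Sum>v\<in>V. (x \<bullet> v) *\<^sub>R v)"
  using orthonormal_basis_expand[OF orthogonal_V norm_V _ finite_V, of x] span_V by simp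

lemma f_expand: "f x = (\<Sum>v\<in>V. (x \<bullet> v) *\<^sub>R f v)"
  by (subst expand) (simp add: linear_sum[OF linear_f] linear_scale[OF linear_f])

lemma q_expand: "q x = (\<Sum>v\<in>V. u v * (x \<bullet> v)\<^sup>2)"
proof -
  have "q x = (\<Sum>v\<in>V. \<Sum>w\<in>V. (x \<bullet> v) * (x \<bullet> w) * (f v \<bullet> f w))"
    unfolding q_def power2_norm_eq_inner
    by (subst (1 2) f_expand) (simp add: inner_sum_left inner_sum_right sum_distrib_left mult_ac inner_commute)
  also have "\<dots> = (\<Sum>v\<in>V. \<Sum>w\<in>V. if w = v then u v * (x \<bullet> v)\<^sup>2 else 0)"
    by (intro sum.cong refl)
      (auto simp: orthogonal_fV u_def dot_square_norm power2_eq_square mult_ac)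
  finally show ?thesis by (simp add: finite_V)
qed

lemma u_pos: "v \<in> V \<Longrightarrow> 0 < u v"
  using inj_f[of v] norm_V[of v] by (auto simp: u_def)

lemma q_pos: "x \<noteq> 0 \<Longrightarrow> 0 < q x"
  using inj_f by (auto simp: q_def)

lemma q_pos_sphere: "x \<in> sphere 0 1 \<Longrightarrow> 0 < q x"
  by (intro q_pos) auto

lemma continuous_q [continuous_intros]: "continuous_on S q"
  unfolding q_def by (intro continuous_intros linear_continuous_on) (simp add: linear_f flip: linear_conv_bounded_linear)

text \<open>Injectivity of \<open>f\<close> keeps \<open>q\<close> positive on the sphere, so the
  negative exponents \<open>p / 2 - 1\<close> and \<open>p / 2 - 2\<close> create no
  singularity.\<close>

lemma continuous_q_powr [continuous_intros]: "continuous_on (sphere 0 1) (\<lambda>x. q x powr r)"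
  using q_pos_sphere by (intro continuous_on_powr continuous_intros) (metis less_irrefl)

lemma integrable_q_powr:
  "continuous_on (sphere 0 1) g \<Longrightarrow> integrable M (\<lambda>x. g x * q x powr r)"
  by (intro integrable_continuous continuous_intros)

lemma W_sym: "W v w = W w v"
  by (simp add: W_def mult.commute)

text \<open>By \<open>q_expand\<close>, the weighted sum of the squares
  \<open>(x \<bullet> w)\<^sup>2\<close> is one factor \<open>q x\<close>, which raises the exponent
  by one. \<open>P_sum\<close> is the same contraction one degree lower.\<close>

lemma W_row:
  assumes "v \<in> V"
  shows "(\<Sum>w\<in>V. u w * W v w) = P v"
proof -
  have "(\<Sum>w\<in>V. u w * W v w) = (\<integral>x. (\<Sum>w\<in>V. u w * ((x \<bullet> v)\<^sup>2 * (x \<bullet> w)\<^sup>2 * q x powr (p / 2 - 2))) \<partial>M)"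
    unfolding W_def
    by (subst Bochner_Integration.integral_sum)
      (auto intro!: integrable_q_powr integrable_mult_right continuous_intros)
  also have "\<dots> = P v"
    unfolding P_def
  proof (intro Bochner_Integration.integral_cong refl)
    fix x assume "x \<in> space M"
    then have x: "0 < q x" using q_pos_sphere by (simp add: space_M)
    have "(\<Sum>w\<in>V. u w * ((x \<bullet> v)\<^sup>2 * (x \<bullet> w)\<^sup>2 * q x powr (p / 2 - 2)))
      = (x \<bullet> v)\<^sup>2 * (q x powr (p / 2 - 2) * q x)"
      by (simp add: q_expand sum_distrib_left sum_distrib_right mult_ac)
    also have "q x powr (p / 2 - 2) * q x = q x powr (p / 2 - 1)"
      using powr_add[of "q x" "p / 2 - 2" 1] x by simp
    finally show "(\<Sum>w\<in>V. u w * ((x \<bullet> v)\<^sup>2 * (x \<bullet> w)\<^sup>2 * q x powr (p / 2 - 2)))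
      = (x \<bullet> v)\<^sup>2 * q x powr (p / 2 - 1)" .
  qed
  finally show ?thesis .
qed

lemma P_sum: "(\<Sum>v\<in>V. u v * P v) = F"
proof -
  have "(\<Sum>v\<in>V. u v * P v) = (\<integral>x. (\<Sum>v\<in>V. u v * ((x \<bullet> v)\<^sup>2 * q x powr (p / 2 - 1))) \<partial>M)"
    unfolding P_def
    by (subst Bochner_Integration.integral_sum)
      (auto intro!: integrable_q_powr integrable_mult_right continuous_intros)
  also have "\<dots> = F"
    unfolding F_def
  proof (intro Bochner_Integration.integral_cong refl)
    fix x assume "x \<in> space M"
    then have x: "0 < q x" using q_pos_sphere by (simp add: space_M)
    have "(\<Sum>v\<in>V. u v * ((x \<bullet> v)\<^sup>2 * q x powr (p / 2 - 1))) = q x powr (p / 2 - 1) * q x"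
      by (subst (3) q_expand) (simp add: sum_distrib_left mult_ac)
    also have "\<dots> = q x powr (p / 2)"
      using powr_add[of "q x" "p / 2 - 1" 1] x by simp
    finally show "(\<Sum>v\<in>V. u v * ((x \<bullet> v)\<^sup>2 * q x powr (p / 2 - 1))) = q x powr (p / 2)" .
  qed
  finally show ?thesis .
qed

lemma P_nonneg: "0 \<le> P v" and W_nonneg: "0 \<le> W v w" and F_nonneg: "0 \<le> F"
  by (simp_all add: P_def W_def F_def)

lemma q_reflect: "v \<in> V \<Longrightarrow> q (reflect v x) = q x"
  unfolding q_expand by (intro sum.cong refl) (auto simp: reflect_def inner_diff_left inner_V)

lemma inner_reflect:
  "v \<in> V \<Longrightarrow> w \<in> V \<Longrightarrow> reflect v x \<bullet> w = (if v = w then - (x \<bullet> w) else x \<bullet> w)"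
  by (auto simp: reflect_def inner_diff_left inner_V)

text \<open>Reflecting along \<open>v\<close> fixes \<open>q\<close> and flips only the coordinate
  \<open>x \<bullet> v\<close>, so mixed moments are odd.\<close>

lemma second_moment:
  assumes "v \<in> V" "w \<in> V"
  shows "(\<integral>x. (x \<bullet> v) * (x \<bullet> w) * q x powr (p / 2 - 1) \<partial>M) = (if v = w then P v else 0)"
proof (cases "v = w")
  case False
  have "(\<integral>x. (x \<bullet> v) * (x \<bullet> w) * q x powr (p / 2 - 1) \<partial>M) = 0"
    using assms False
    by (intro integral_odd[OF orthogonal_reflect[of v]] continuous_intros)
      (auto simp: inner_V inner_reflect q_reflect)
  with False show ?thesis by simp
qed (simp add: P_def power2_eq_square)

text \<open>A moment survives only if its four indices match in pairs; otherwise some index occurs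
  an odd number of times, and the reflection along it changes the sign. The guard
  \<open>a \<noteq> b\<close> keeps the case of four equal indices from being counted twice.\<close>

lemma fourth_moment:
  assumes "a \<in> V" "b \<in> V" "c \<in> V" "d \<in> V"
  shows "(\<integral>x. (x \<bullet> a) * (x \<bullet> b) * (x \<bullet> c) * (x \<bullet> d) * q x powr (p / 2 - 2) \<partial>M)
    = (if a = b \<and> c = d then W a c
       else if a \<noteq> b \<and> (a = c \<and> b = d \<or> a = d \<and> b = c) then W a b else 0)" (is "?I = _")
proof -
  have zero: "?I = 0"
    if "e \<in> V" "\<And>x. (reflect e x \<bullet> a) * (reflect e x \<bullet> b) * (reflect e x \<bullet> c) * (reflect e x \<bullet> d)
      = - ((x \<bullet> a) * (x \<bullet> b) * (x \<bullet> c) * (x \<bullet> d))" for e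
    using that(1)
    by (intro integral_odd[OF orthogonal_reflect[of e]] continuous_intros)
      (auto simp: inner_V q_reflect that(2))
  \<comment> \<open>The cases may overlap. In the last five, the index handed to \<open>zero\<close>
    occurs once or, in the last case, possibly three times.\<close>
  consider "a = b" "c = d" | "a \<noteq> b" "a = c" "b = d" | "a \<noteq> b" "a = d" "b = c"
    | "a = b" "c \<noteq> d" "a \<noteq> c" | "a = b" "c \<noteq> d" "a = c"
    | "a \<noteq> b" "c \<noteq> a" "d \<noteq> a" | "a \<noteq> b" "c \<noteq> b" "d \<noteq> b" | "a \<noteq> b" "c = d"
    by metis
  then show ?thesis
  proof cases
    case 1 then show ?thesis by (simp add: W_def power2_eq_square mult_ac)
  next
    case 2 then show ?thesis by (simp add: W_def power2_eq_square mult_ac)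
  next
    case 3 then show ?thesis by (simp add: W_def power2_eq_square mult_ac)
  next
    case 4 then show ?thesis using assms by (subst zero[of c]) (auto simp: inner_reflect)
  next
    case 5 then show ?thesis using assms by (subst zero[of d]) (auto simp: inner_reflect)
  next
    case 6 then show ?thesis using assms by (subst zero[of a]) (auto simp: inner_reflect)
  next
    case 7 then show ?thesis using assms by (subst zero[of b]) (auto simp: inner_reflect)
  next
    case 8 then show ?thesis using assms by (subst zero[of a]) (auto simp: inner_reflect)
  qed
qed

end

subsection \<open>Inequalities for pairs of singular directions\<close>

context singular_basis
begin

context
  fixes v w
  assumes vw: "v \<in> V" "w \<in> V" "v \<noteq> w"
begin

abbreviation "rot \<equiv> plane_rotation v w"

lemma vw_inner: "v \<bullet> v = 1" "w \<bullet> w = 1" "v \<bullet> w = 0"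
  using vw by (simp_all add: inner_V)

text \<open>Along the orbit of \<open>x\<close> the coordinates in the plane are
  \<open>r * cos (t + a)\<close> and \<open>r * sin (t + a)\<close>, so \<open>q\<close> has exactly
  the form treated in \<open>circle_inequalities\<close>, and the moments differ from those on the
  circle by powers of \<open>r\<close>.\<close>

lemma rotation_averages:
  assumes x: "x \<in> sphere 0 1" and le: "u w \<le> u v"
  defines "S \<equiv> \<integral>t. q (rot t x) powr (p / 2) \<partial>circle"
    and "p1 \<equiv> \<integral>t. (rot t x \<bullet> v)\<^sup>2 * q (rot t x) powr (p / 2 - 1) \<partial>circle"
    and "p2 \<equiv> \<integral>t. (rot t x \<bullet> w)\<^sup>2 * q (rot t x) powr (p / 2 - 1) \<partial>circle"
    and "w0 \<equiv> \<integral>t. (rot t x \<bullet> v)\<^sup>2 * (rot t x \<bullet> w)\<^sup>2 * q (rot t x) powr (p / 2 - 2) \<partial>circle"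
  shows "(2 - p) * (u v - u w) * w0 = p2 - p1"
    and "(1 - p) * (p1 * p2) \<le> (2 - p) * (S * w0)"
    and "(2 - p) * (w0 * (u v * p1 + u w * p2)) \<le> p1 * p2"
    and "w0 = 0 \<or> 0 < p1 \<and> 0 < p2"
proof -
  obtain r a where ra: "x \<bullet> v = r * cos a" "x \<bullet> w = r * sin a"
    using polar_Ex by metis
  have rv: "rot t x \<bullet> v = r * cos (t + a)" and rw: "rot t x \<bullet> w = r * sin (t + a)" for t
    by (simp_all add: plane_rotation_inner vw_inner ra cos_add sin_add algebra_simps)
  define k where "k = (\<Sum>y\<in>V - {v, w}. u y * (x \<bullet> y)\<^sup>2)"
  have k: "0 \<le> k" unfolding k_def using u_pos by (intro sum_nonneg) (auto simp: less_imp_le)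
  have q_split: "q z = u v * (z \<bullet> v)\<^sup>2 + u w * (z \<bullet> w)\<^sup>2 + (\<Sum>y\<in>V - {v, w}. u y * (z \<bullet> y)\<^sup>2)" for z
  proof -
    have "V - {v} - {w} = V - {v, w}" by blast
    then show ?thesis
      using sum.remove[OF finite_V vw(1), of "\<lambda>y. u y * (z \<bullet> y)\<^sup>2"]
        sum.remove[of "V - {v}" w "\<lambda>y. u y * (z \<bullet> y)\<^sup>2"] finite_V vw
      by (simp add: q_expand)
  qed
  have rest: "(\<Sum>y\<in>V - {v, w}. u y * (rot t x \<bullet> y)\<^sup>2) = k" for t
    unfolding k_def
    by (intro sum.cong refl) (use vw in \<open>auto simp: plane_rotation_inner vw_inner inner_V\<close>)
  \<comment> \<open>The coordinates fixed by the rotation contribute \<open>k\<close>, absorbed using \<open>cos\<^sup>2 + sin\<^sup>2 = 1\<close>.\<close>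
  define U U' where "U = sqrt (u v * r\<^sup>2 + k)" and "U' = sqrt (u w * r\<^sup>2 + k)"
  have uv: "0 < u v" "0 < u w" using u_pos vw by auto
  have U2: "U\<^sup>2 = u v * r\<^sup>2 + k" and U'2: "U'\<^sup>2 = u w * r\<^sup>2 + k"
    using k uv by (simp_all add: U_def U'_def)
  have q_rot: "q (rot t x) = U\<^sup>2 * (cos (t + a))\<^sup>2 + U'\<^sup>2 * (sin (t + a))\<^sup>2" for t
  proof -
    have "q (rot t x) = u v * (r * cos (t + a))\<^sup>2 + u w * (r * sin (t + a))\<^sup>2
        + k * ((cos (t + a))\<^sup>2 + (sin (t + a))\<^sup>2)"
      by (simp add: q_split[of "rot t x"] rest rv rw)
    then show ?thesis unfolding U2 U'2 by algebra
  qed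
  \<comment> \<open>Were this zero, all terms of \<open>q x\<close> would vanish, against
    injectivity of \<open>f\<close>.\<close>
  have "0 < u w * r\<^sup>2 + k"
  proof (rule ccontr)
    assume "\<not> 0 < u w * r\<^sup>2 + k"
    moreover have "0 \<le> u w * r\<^sup>2" using uv by simp
    ultimately have "k = 0" "u w * r\<^sup>2 = 0" using k by linarith+
    then have "k = 0" "r = 0" using uv by auto
    then have "q x = 0" using q_split[of x] by (simp add: ra flip: k_def)
    then show False using q_pos_sphere[OF x] by simp
  qed
  then have U': "0 < U'" by (simp add: U'_def)
  have UU': "U' \<le> U" using le by (simp add: U_def U'_def mult_right_mono)
  note ineq = circle_inequalities[OF UU' U' p, of a, folded q_rot]
  define S' P1 P2 W0 where "S' = (\<integral>t. q (rot t x) powr (p / 2) \<partial>circle)"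
    and "P1 = (\<integral>t. (cos (t + a))\<^sup>2 * q (rot t x) powr (p / 2 - 1) \<partial>circle)"
    and "P2 = (\<integral>t. (sin (t + a))\<^sup>2 * q (rot t x) powr (p / 2 - 1) \<partial>circle)"
    and "W0 = (\<integral>t. (cos (t + a))\<^sup>2 * (sin (t + a))\<^sup>2 * q (rot t x) powr (p / 2 - 2) \<partial>circle)"
  note ineq = ineq[folded S'_def P1_def P2_def W0_def]
  define R where "R = r\<^sup>2"
  have "S = S'" "p1 = r\<^sup>2 * P1" "p2 = r\<^sup>2 * P2" "w0 = r ^ 4 * W0"
    by (simp_all add: S_def S'_def p1_def p2_def w0_def P1_def P2_def W0_def rv rw power_mult_distrib
        mult_ac power4_eq_xxxx power2_eq_square[of r] flip: integral_mult_right_zero)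
  then have eqs: "S = S'" "p1 = R * P1" "p2 = R * P2" "w0 = R * R * W0"
    by (simp_all add: R_def)
  have R: "0 \<le> R" by (simp add: R_def)
  show "(2 - p) * (u v - u w) * w0 = p2 - p1"
  proof -
    have "(2 - p) * (u v - u w) * w0 = R * ((2 - p) * (U\<^sup>2 - U'\<^sup>2) * W0)"
      by (simp add: U2 U'2 eqs algebra_simps flip: R_def)
    also have "\<dots> = R * (P2 - P1)" by (simp only: ineq(3))
    finally show ?thesis by (simp add: eqs right_diff_distrib)
  qed
  show "(1 - p) * (p1 * p2) \<le> (2 - p) * (S * w0)"
    using mult_left_mono[OF ineq(5), of "R * R"] R by (simp add: eqs mult_ac)
  show "(2 - p) * (w0 * (u v * p1 + u w * p2)) \<le> p1 * p2"
  proof -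
    have W0: "0 \<le> W0" by (simp add: W0_def)
    \<comment> \<open>The difference is \<open>k * (P1 + P2)\<close>, the share of the coordinates
      outside the plane.\<close>
    have "u v * p1 + u w * p2 \<le> S'"
      using ineq(1,2) k by (simp add: ineq(4) eqs U2 U'2 algebra_simps add_nonneg_nonneg flip: R_def)
    then have "(2 - p) * (w0 * (u v * p1 + u w * p2)) \<le> (2 - p) * (w0 * S')"
      using p W0 by (intro mult_left_mono) (auto simp: eqs R)
    also have "\<dots> \<le> p1 * p2"
      using mult_left_mono[OF ineq(6), of "R * R"] R by (simp add: eqs mult_ac)
    finally show ?thesis .
  qed
  show "w0 = 0 \<or> 0 < p1 \<and> 0 < p2"
    using ineq(1,2) R by (cases "R = 0") (auto simp: eqs zero_less_mult_iff)
qed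

text \<open>Products of averages do not survive a further averaging, so each inequality is replaced
  by linear ones with free parameters. In the second, minimising the right-hand side over
  \<open>y + z = 1\<close> gives, for positive moments,
  \<open>P v * P w / (u v * P v + u w * P w)\<close>, the off-diagonal bound.\<close>

lemma pair_inequalities_aux:
  assumes le: "u w \<le> u v"
  shows "(1 - p) * (P v * P w) \<le> (2 - p) * (F * W v w)"
    and "(2 - p) * (y + z)\<^sup>2 * W v w \<le> y\<^sup>2 / u v * P w + z\<^sup>2 / u w * P v"
proof -
  have uv: "0 < u v" "0 < u w" using u_pos vw by auto
  note nonneg = integral_nonneg_by_rotation[OF vw_inner]
  define gS gv gw gW where "gS x = q x powr (p / 2)"
    and "gv x = (x \<bullet> v)\<^sup>2 * q x powr (p / 2 - 1)"
    and "gw x = (x \<bullet> w)\<^sup>2 * q x powr (p / 2 - 1)"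
    and "gW x = (x \<bullet> v)\<^sup>2 * (x \<bullet> w)\<^sup>2 * q x powr (p / 2 - 2)" for x
  have [continuous_intros]: "continuous_on (sphere 0 1) gS" "continuous_on (sphere 0 1) gv"
    "continuous_on (sphere 0 1) gw" "continuous_on (sphere 0 1) gW"
    unfolding gS_def[abs_def] gv_def[abs_def] gw_def[abs_def] gW_def[abs_def]
    by (intro continuous_intros)+
  \<comment> \<open>The transfer principle: a linear inequality with fixed coefficients that holds
    for the averages on every orbit holds for the integrals over the sphere.\<close>
  have comb: "0 \<le> c1 * F + c2 * P v + c3 * P w + c4 * W v w"
    if pt: "\<And>x. x \<in> sphere 0 1 \<Longrightarrow>
      0 \<le> c1 * (\<integral>t. gS (rot t x) \<partial>circle) + c2 * (\<integral>t. gv (rot t x) \<partial>circle)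
        + c3 * (\<integral>t. gw (rot t x) \<partial>circle) + c4 * (\<integral>t. gW (rot t x) \<partial>circle)" for c1 c2 c3 c4
  proof -
    have "0 \<le> (\<integral>x. c1 * gS x + c2 * gv x + c3 * gw x + c4 * gW x \<partial>M)"
    proof (rule nonneg)
      fix x assume x: "x \<in> sphere (0::'a) 1"
      have i: "integrable circle (\<lambda>t. gS (rot t x))" "integrable circle (\<lambda>t. gv (rot t x))"
        "integrable circle (\<lambda>t. gw (rot t x))" "integrable circle (\<lambda>t. gW (rot t x))"
        by (rule integral_plane_rotation(2)[OF vw_inner _ x]; intro continuous_intros)+
      show "0 \<le> (\<integral>t. c1 * gS (rot t x) + c2 * gv (rot t x) + c3 * gw (rot t x) + c4 * gW (rot t x) \<partial>circle)"
        using pt[OF x] i by simp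
    qed (intro continuous_intros)
    moreover have "integrable M gS" "integrable M gv" "integrable M gw" "integrable M gW"
      by (intro integrable_continuous continuous_intros)+
    moreover have "F = (\<integral>x. gS x \<partial>M)" "P v = (\<integral>x. gv x \<partial>M)" "P w = (\<integral>x. gw x \<partial>M)"
      "W v w = (\<integral>x. gW x \<partial>M)"
      by (simp_all add: F_def P_def W_def gS_def gv_def gw_def gW_def)
    ultimately show ?thesis by simp
  qed
  define S p1 p2 w0 where "S x = (\<integral>t. gS (rot t x) \<partial>circle)" and "p1 x = (\<integral>t. gv (rot t x) \<partial>circle)"
    and "p2 x = (\<integral>t. gw (rot t x) \<partial>circle)" and "w0 x = (\<integral>t. gW (rot t x) \<partial>circle)" for x
  note comb = comb[folded S_def p1_def p2_def w0_def]
  note av = rotation_averages[OF _ le, folded gS_def gv_def gw_def gW_def, folded S_def p1_def p2_def w0_def]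
  have nn: "0 \<le> S x" "0 \<le> w0 x" for x
    by (simp_all add: S_def w0_def gS_def gW_def)
  let ?\<delta> = "(2 - p) * (u v - u w)"
  \<comment> \<open>Equality on every orbit, transferred as two opposite inequalities.\<close>
  have D: "?\<delta> * W v w = P w - P v"
  proof -
    have "0 \<le> 0 * F + 1 * P v + (- 1) * P w + ?\<delta> * W v w"
      by (rule comb) (simp add: av)
    moreover have "0 \<le> 0 * F + (- 1) * P v + 1 * P w + (- ?\<delta>) * W v w"
      by (rule comb) (simp add: av del: minus_mult_left[symmetric] minus_diff_eq)
    ultimately show ?thesis by simp
  qed
  \<comment> \<open>Since \<open>4 p1 p2 = (p1 + p2)\<^sup>2 - (p2 - p1)\<^sup>2\<close> and \<open>p2 - p1\<close> is a multiple of \<open>w0\<close>, the pointwise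
    inequality is a discriminant condition whose coefficients are linear in the averages.\<close>
  define \<kappa> where "\<kappa> = sqrt (1 - p)"
  have \<kappa>: "\<kappa>\<^sup>2 = 1 - p" using p by (simp add: \<kappa>_def)
  let ?e = "(1 - p) * ?\<delta>\<^sup>2"
  have "(\<kappa> * (P v + P w))\<^sup>2 \<le> ((2 - p) * W v w) * (4 * F + ?e / (2 - p) * W v w)"
  proof (rule discriminant_le)
    show "0 \<le> (2 - p) * W v w" using p W_nonneg by simp
    fix l :: real
    have "0 \<le> 4 * F + (- 2 * l * \<kappa>) * P v + (- 2 * l * \<kappa>) * P w + ((2 - p) * l\<^sup>2 + ?e / (2 - p)) * W v w"
    proof (rule comb)
      fix x assume x: "x \<in> sphere (0::'a) 1"
      define A B C where "A = (2 - p) * w0 x" and "B = \<kappa> * (p1 x + p2 x)"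
        and "C = 4 * S x + ?e / (2 - p) * w0 x"
      have AC: "0 \<le> A" "0 \<le> C" unfolding A_def C_def using p nn[of x] by auto
      have "B\<^sup>2 = (1 - p) * (p2 x - p1 x)\<^sup>2 + 4 * ((1 - p) * (p1 x * p2 x))"
        unfolding B_def power_mult_distrib \<kappa> by algebra
      also have "\<dots> \<le> (1 - p) * (?\<delta> * w0 x)\<^sup>2 + 4 * ((2 - p) * (S x * w0 x))"
        using av(1,2)[OF x] by simp
      also have "\<dots> = A * C"
        using p by (simp add: A_def C_def power2_eq_square field_simps)
      finally have BAC: "B\<^sup>2 \<le> A * C" .
      have "0 \<le> A * l\<^sup>2 - 2 * B * l + C"
      proof (cases "A = 0")
        case True
        then have "B = 0" using BAC by simp
        then show ?thesis using True AC by simp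
      next
        case False
        then have "0 < A" using AC by simp
        have "0 \<le> (A * l - B)\<^sup>2 + (A * C - B\<^sup>2)" using BAC by simp
        also have "\<dots> = A * (A * l\<^sup>2 - 2 * B * l + C)" by (simp add: power2_eq_square algebra_simps)
        finally show ?thesis using \<open>0 < A\<close> by (simp add: zero_le_mult_iff)
      qed
      then show "0 \<le> 4 * S x + (- 2 * l * \<kappa>) * p1 x + (- 2 * l * \<kappa>) * p2 x
          + ((2 - p) * l\<^sup>2 + ?e / (2 - p)) * w0 x"
        by (simp add: A_def B_def C_def algebra_simps)
    qed
    then show "0 \<le> (2 - p) * W v w * l\<^sup>2 - 2 * (\<kappa> * (P v + P w)) * l + (4 * F + ?e / (2 - p) * W v w)"
      by (simp add: algebra_simps)
  qed
  also have "\<dots> = 4 * ((2 - p) * (F * W v w)) + (1 - p) * (?\<delta> * W v w)\<^sup>2"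
    using p by (simp add: power2_eq_square field_simps)
  finally show "(1 - p) * (P v * P w) \<le> (2 - p) * (F * W v w)"
    unfolding D power_mult_distrib \<kappa> by (simp add: power2_eq_square algebra_simps)
  have "0 \<le> 0 * F + z\<^sup>2 / u w * P v + y\<^sup>2 / u v * P w + (- ((2 - p) * (y + z)\<^sup>2)) * W v w"
  proof (rule comb)
    fix x assume x: "x \<in> sphere (0::'a) 1"
    have "(2 - p) * (y + z)\<^sup>2 * w0 x \<le> z\<^sup>2 / u w * p1 x + y\<^sup>2 / u v * p2 x"
    proof (cases "w0 x = 0")
      case True
      have "0 \<le> p1 x" "0 \<le> p2 x" by (simp_all add: p1_def p2_def gv_def gw_def)
      then show ?thesis using True uv by simp
    next
      case False
      then have pos: "0 < p1 x" "0 < p2 x" using av(4)[OF x] by auto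
      define E where "E = u v * p1 x + u w * p2 x"
      have E: "0 < E" using pos uv by (simp add: E_def add_pos_pos)
      \<comment> \<open>Cauchy-Schwarz; the defect is the explicit square displayed next.\<close>
      have "(y + z)\<^sup>2 * (p1 x * p2 x) \<le> (z\<^sup>2 / u w * p1 x + y\<^sup>2 / u v * p2 x) * E"
      proof -
        have "(z\<^sup>2 / u w * p1 x + y\<^sup>2 / u v * p2 x) * E - (y + z)\<^sup>2 * (p1 x * p2 x)
          = (z * u v * p1 x - y * u w * p2 x)\<^sup>2 / (u v * u w)"
          using uv by (simp add: E_def field_simps power2_eq_square)
        also have "\<dots> \<ge> 0" using uv by simp
        finally show ?thesis by simp
      qed
      moreover have "(y + z)\<^sup>2 * ((2 - p) * (w0 x * E)) \<le> (y + z)\<^sup>2 * (p1 x * p2 x)"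
        using av(3)[OF x] unfolding E_def by (intro mult_left_mono) auto
      ultimately have "((2 - p) * (y + z)\<^sup>2 * w0 x) * E \<le> (z\<^sup>2 / u w * p1 x + y\<^sup>2 / u v * p2 x) * E"
        by (simp add: mult_ac)
      then show ?thesis using E by simp
    qed
    then show "0 \<le> 0 * S x + z\<^sup>2 / u w * p1 x + y\<^sup>2 / u v * p2 x + (- ((2 - p) * (y + z)\<^sup>2)) * w0 x"
      by simp
  qed
  then show "(2 - p) * (y + z)\<^sup>2 * W v w \<le> y\<^sup>2 / u v * P w + z\<^sup>2 / u w * P v"
    by simp
qed

end

lemma pair_inequalities:
  assumes vw: "v \<in> V" "w \<in> V" "v \<noteq> w"
  shows "(1 - p) * (P v * P w) \<le> (2 - p) * (F * W v w)"
    and "(2 - p) * (y + z)\<^sup>2 * W v w \<le> y\<^sup>2 / u v * P w + z\<^sup>2 / u w * P v"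
proof -
  consider "u w \<le> u v" | "u v \<le> u w" by linarith
  then show "(1 - p) * (P v * P w) \<le> (2 - p) * (F * W v w)"
    and "(2 - p) * (y + z)\<^sup>2 * W v w \<le> y\<^sup>2 / u v * P w + z\<^sup>2 / u w * P v"
    using pair_inequalities_aux(1)[OF vw] pair_inequalities_aux(2)[OF vw, of y z]
      pair_inequalities_aux(1)[OF vw(2,1) vw(3)[symmetric]]
      pair_inequalities_aux(2)[OF vw(2,1) vw(3)[symmetric], of z y]
    by (auto simp: W_sym[of w v] mult.commute add.commute)
qed

end

subsection \<open>The Hessian along a line\<close>

context singular_basis
begin

lemma integral_quadratic:
  "(\<integral>x. (\<Sum>v\<in>V. \<Sum>w\<in>V. c v w * ((x \<bullet> v) * (x \<bullet> w))) * q x powr (p / 2 - 1) \<partial>M) = (\<Sum>v\<in>V. c v v * P v)"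
proof -
  have i: "integrable M (\<lambda>x. c v w * ((x \<bullet> v) * (x \<bullet> w) * q x powr (p / 2 - 1)))" for v w
    by (intro integrable_mult_right integrable_q_powr continuous_intros)
  have "(\<integral>x. (\<Sum>v\<in>V. \<Sum>w\<in>V. c v w * ((x \<bullet> v) * (x \<bullet> w))) * q x powr (p / 2 - 1) \<partial>M)
    = (\<integral>x. (\<Sum>v\<in>V. \<Sum>w\<in>V. c v w * ((x \<bullet> v) * (x \<bullet> w) * q x powr (p / 2 - 1))) \<partial>M)"
    by (simp add: sum_distrib_right mult.assoc)
  also have "\<dots> = (\<Sum>v\<in>V. \<Sum>w\<in>V. c v w * (\<integral>x. (x \<bullet> v) * (x \<bullet> w) * q x powr (p / 2 - 1) \<partial>M))"
    by ((rule trans[OF Bochner_Integration.integral_sum], intro Bochner_Integration.integrable_sum i,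
        rule sum.cong[OF refl])+, rule integral_mult_right_zero)
  also have "\<dots> = (\<Sum>v\<in>V. \<Sum>w\<in>V. if w = v then c v v * P v else 0)"
    by (intro sum.cong refl) (simp add: second_moment)
  also have "\<dots> = (\<Sum>v\<in>V. c v v * P v)" by (simp add: finite_V)
  finally show ?thesis .
qed

text \<open>Of the three pairings in \<open>fourth_moment\<close>, the pairing \<open>a = b\<close>,
  \<open>c = d\<close> yields the diagonal sum, and the two crossed ones yield
  \<open>(m a b)\<^sup>2\<close> and \<open>m a b * m b a\<close>.\<close>

lemma integral_quartic:
  "(\<integral>x. (\<Sum>v\<in>V. \<Sum>w\<in>V. m v w * ((x \<bullet> v) * (x \<bullet> w)))\<^sup>2 * q x powr (p / 2 - 2) \<partial>M)
    = (\<Sum>a\<in>V. \<Sum>c\<in>V. m a a * m c c * W a c)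
      + (\<Sum>a\<in>V. \<Sum>b\<in>V. if a = b then 0 else ((m a b)\<^sup>2 + m a b * m b a) * W a b)"
proof -
  let ?X = "\<lambda>a b c d x. (x \<bullet> a) * (x \<bullet> b) * (x \<bullet> c) * (x \<bullet> d) * q x powr (p / 2 - 2)"
  have i: "integrable M (\<lambda>x. m a b * m c d * ?X a b c d x)" for a b c d
    by (intro integrable_mult_right integrable_q_powr continuous_intros)
  have "(\<integral>x. (\<Sum>v\<in>V. \<Sum>w\<in>V. m v w * ((x \<bullet> v) * (x \<bullet> w)))\<^sup>2 * q x powr (p / 2 - 2) \<partial>M)
    = (\<integral>x. (\<Sum>a\<in>V. \<Sum>b\<in>V. \<Sum>c\<in>V. \<Sum>d\<in>V. m a b * m c d * ?X a b c d x) \<partial>M)"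
  proof (intro Bochner_Integration.integral_cong refl)
    fix x
    define A where "A v w = m v w * ((x \<bullet> v) * (x \<bullet> w))" for v w
    define r where "r = q x powr (p / 2 - 2)"
    have "(\<Sum>v\<in>V. \<Sum>w\<in>V. A v w)\<^sup>2 * r
        = (\<Sum>a\<in>V. \<Sum>b\<in>V. A a b * ((\<Sum>v\<in>V. \<Sum>w\<in>V. A v w) * r))"
      unfolding power2_eq_square mult.assoc sum_distrib_right[of _ _ "(\<Sum>v\<in>V. \<Sum>w\<in>V. A v w) * r"] ..
    also have "\<dots> = (\<Sum>a\<in>V. \<Sum>b\<in>V. \<Sum>c\<in>V. \<Sum>d\<in>V. A a b * (A c d * r))"
      by (simp only: sum_distrib_left sum_distrib_right)
    finally show "(\<Sum>v\<in>V. \<Sum>w\<in>V. m v w * ((x \<bullet> v) * (x \<bullet> w)))\<^sup>2 * q x powr (p / 2 - 2)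
        = (\<Sum>a\<in>V. \<Sum>b\<in>V. \<Sum>c\<in>V. \<Sum>d\<in>V. m a b * m c d * ?X a b c d x)"
      by (simp add: A_def r_def mult_ac)
  qed
  also have "\<dots> = (\<Sum>a\<in>V. \<Sum>b\<in>V. \<Sum>c\<in>V. \<Sum>d\<in>V. m a b * m c d * (\<integral>x. ?X a b c d x \<partial>M))"
    by ((rule trans[OF Bochner_Integration.integral_sum], intro Bochner_Integration.integrable_sum i,
        rule sum.cong[OF refl])+, rule integral_mult_right_zero)
  \<comment> \<open>The conditions are nested, not conjoined, so that each inner sum collapses to a
    single term.\<close>
  also have "\<dots> = (\<Sum>a\<in>V. \<Sum>b\<in>V. \<Sum>c\<in>V. \<Sum>d\<in>V.
      (if a = b then if c = d then m a b * m c d * W a c else 0 else 0)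
      + (if a = b then 0 else (if c = a then if d = b then m a b * m c d * W a b else 0 else 0)
        + (if c = b then if d = a then m a b * m c d * W a b else 0 else 0)))"
    by (intro sum.cong refl) (subst fourth_moment, auto)
  also have "\<dots> = (\<Sum>a\<in>V. \<Sum>b\<in>V. (if a = b then \<Sum>c\<in>V. m a b * m c c * W a c else 0)
      + (if a = b then 0 else m a b * m a b * W a b + m a b * m b a * W a b))"
  proof (intro sum.cong refl)
    fix a b assume ab: "a \<in> V" "b \<in> V"
    show "(\<Sum>c\<in>V. \<Sum>d\<in>V.
      (if a = b then if c = d then m a b * m c d * W a c else 0 else 0)
      + (if a = b then 0 else (if c = a then if d = b then m a b * m c d * W a b else 0 else 0)
        + (if c = b then if d = a then m a b * m c d * W a b else 0 else 0)))
      = (if a = b then \<Sum>c\<in>V. m a b * m c c * W a c else 0)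
      + (if a = b then 0 else m a b * m a b * W a b + m a b * m b a * W a b)"
    proof (cases "a = b")
      case False
      have "(\<Sum>c\<in>V. \<Sum>d\<in>V. if c = a then if d = b then m a b * m c d * W a b else 0 else 0)
          = (\<Sum>c\<in>V. if c = a then m a b * m a b * W a b else 0)"
        using ab finite_V by (intro sum.cong refl) simp
      moreover have "(\<Sum>c\<in>V. \<Sum>d\<in>V. if c = b then if d = a then m a b * m c d * W a b else 0 else 0)
          = (\<Sum>c\<in>V. if c = b then m a b * m b a * W a b else 0)"
        using ab finite_V by (intro sum.cong refl) simp
      ultimately show ?thesis using False ab finite_V by (simp add: sum.distrib)
    qed (use finite_V in simp)
  qed
  also have "\<dots> = (\<Sum>a\<in>V. \<Sum>c\<in>V. m a a * m c c * W a c)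
      + (\<Sum>a\<in>V. \<Sum>b\<in>V. if a = b then 0 else ((m a b)\<^sup>2 + m a b * m b a) * W a b)"
  proof -
    have "(\<Sum>a\<in>V. \<Sum>b\<in>V. if a = b then \<Sum>c\<in>V. m a b * m c c * W a c else 0)
        = (\<Sum>a\<in>V. \<Sum>c\<in>V. m a a * m c c * W a c)"
      by (rule sum.cong[OF refl]) (simp add: finite_V)
    then show ?thesis by (simp add: sum.distrib power2_eq_square algebra_simps cong: if_cong)
  qed
  finally show ?thesis .
qed

text \<open>Bessel's inequality for the orthonormal vectors \<open>f v / sqrt (u v)\<close>;
  \<open>s\<close> is the projection of \<open>y\<close> onto their span, which may be smaller than
  the codomain.\<close>

lemma bessel:
  "(\<Sum>v\<in>V. (f v \<bullet> y)\<^sup>2 / u v) \<le> (norm y)\<^sup>2"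
proof -
  define s where "s = (\<Sum>v\<in>V. ((f v \<bullet> y) / u v) *\<^sub>R f v)"
  have sy: "s \<bullet> y = (\<Sum>v\<in>V. (f v \<bullet> y)\<^sup>2 / u v)"
    by (simp add: s_def inner_sum_left power2_eq_square)
  have sf: "s \<bullet> f w = f w \<bullet> y" if "w \<in> V" for w
  proof -
    have "s \<bullet> f w = (\<Sum>v\<in>V. if v = w then f w \<bullet> y else 0)"
      unfolding s_def inner_sum_left
    proof (intro sum.cong refl)
      fix v assume "v \<in> V"
      show "((f v \<bullet> y) / u v) *\<^sub>R f v \<bullet> f w = (if v = w then f w \<bullet> y else 0)"
        using \<open>v \<in> V\<close> that u_pos[OF that] orthogonal_fV[of v w]
        by (auto simp: u_def power2_norm_eq_inner)
    qed
    then show ?thesis using that finite_V by simp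
  qed
  have "s \<bullet> s = (\<Sum>v\<in>V. ((f v \<bullet> y) / u v) * (s \<bullet> f v))"
    by (subst (2) s_def) (simp add: inner_sum_right)
  also have "\<dots> = s \<bullet> y"
    unfolding sy by (intro sum.cong refl) (simp add: sf power2_eq_square)
  finally have "(y - s) \<bullet> (y - s) = y \<bullet> y - s \<bullet> y"
    by (simp add: inner_diff_left inner_diff_right inner_commute)
  then show ?thesis
    using inner_ge_zero[of "y - s"] by (simp add: sy power2_norm_eq_inner)
qed

text \<open>Up to a positive factor this is the second derivative of \<open>F powr (1 / p)\<close>
  along \<open>f + t g\<close>. In terms of \<open>m v w\<close>, the form separates into a diagonal
  part, handled by \<open>diagonal_form_nonneg\<close>, and an off-diagonal part that is a sum over
  pairs.\<close>

lemma hessian_nonneg: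
  fixes g :: "'a \<Rightarrow> 'b"
  assumes lin: "linear g"
  shows "0 \<le> F * ((\<integral>x. (norm (g x))\<^sup>2 * q x powr (p / 2 - 1) \<partial>M)
        - (2 - p) * (\<integral>x. (f x \<bullet> g x)\<^sup>2 * q x powr (p / 2 - 2) \<partial>M))
      + (1 - p) * (\<integral>x. (f x \<bullet> g x) * q x powr (p / 2 - 1) \<partial>M)\<^sup>2"
proof -
  define m where "m v w = f v \<bullet> g w" for v w
  have g_expand: "g x = (\<Sum>v\<in>V. (x \<bullet> v) *\<^sub>R g v)" for x
    by (subst expand) (simp add: linear_sum[OF lin] linear_scale[OF lin])
  have fg: "f x \<bullet> g x = (\<Sum>v\<in>V. \<Sum>w\<in>V. m v w * ((x \<bullet> v) * (x \<bullet> w)))" for x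
    by (subst f_expand, subst g_expand)
      (simp only: inner_sum_left, simp add: inner_sum_right m_def mult_ac)
  have gg: "(norm (g x))\<^sup>2 = (\<Sum>v\<in>V. \<Sum>w\<in>V. (g v \<bullet> g w) * ((x \<bullet> v) * (x \<bullet> w)))" for x
    unfolding power2_norm_eq_inner
    by (subst (1 2) g_expand)
      (simp add: inner_sum_left inner_sum_right sum_distrib_left mult_ac inner_commute)
  have I1: "(\<integral>x. (norm (g x))\<^sup>2 * q x powr (p / 2 - 1) \<partial>M) = (\<Sum>w\<in>V. (norm (g w))\<^sup>2 * P w)"
    unfolding gg[of "_ :: 'a"] integral_quadratic by (simp add: gg[symmetric] power2_norm_eq_inner)
  have I2: "(\<integral>x. (f x \<bullet> g x) * q x powr (p / 2 - 1) \<partial>M) = (\<Sum>v\<in>V. m v v * P v)"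
    unfolding fg by (rule integral_quadratic)
  define D where "D = (\<Sum>a\<in>V. \<Sum>c\<in>V. m a a * m c c * W a c)"
  define E where "E = (\<Sum>a\<in>V. \<Sum>b\<in>V. if a = b then 0 else ((m a b)\<^sup>2 + m a b * m b a) * W a b)"
  have I3: "(\<integral>x. (f x \<bullet> g x)\<^sup>2 * q x powr (p / 2 - 2) \<partial>M) = D + E"
    unfolding fg D_def E_def by (rule integral_quartic)
  define G where "G = (\<Sum>v\<in>V. \<Sum>w\<in>V. if v = w then 0 else (m v w)\<^sup>2 / u v * P w)"
  have "(\<Sum>w\<in>V. (\<Sum>v\<in>V. (m v w)\<^sup>2 / u v) * P w) \<le> (\<Sum>w\<in>V. (norm (g w))\<^sup>2 * P w)"
    unfolding m_def by (intro sum_mono mult_right_mono bessel P_nonneg)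
  also have "(\<Sum>w\<in>V. (\<Sum>v\<in>V. (m v w)\<^sup>2 / u v) * P w) = (\<Sum>v\<in>V. \<Sum>w\<in>V. (m v w)\<^sup>2 / u v * P w)"
    unfolding sum_distrib_right by (rule sum.swap)
  also have "\<dots> = (\<Sum>v\<in>V. \<Sum>w\<in>V. (if w = v then (m v v)\<^sup>2 / u v * P v else 0)
      + (if v = w then 0 else (m v w)\<^sup>2 / u v * P w))"
    by (intro sum.cong refl) simp
  also have "\<dots> = (\<Sum>v\<in>V. (m v v)\<^sup>2 / u v * P v) + G"
    by (simp add: sum.distrib finite_V G_def)
  finally have I1_ge: "(\<Sum>v\<in>V. (m v v)\<^sup>2 / u v * P v) + G \<le> (\<Sum>w\<in>V. (norm (g w))\<^sup>2 * P w)" .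
  have "0 \<le> G - (2 - p) * E"
  proof -
    let ?h = "\<lambda>a b. if a = b then 0 else (m a b)\<^sup>2 / u a * P b - (2 - p) * (((m a b)\<^sup>2 + m a b * m b a) * W a b)"
    have eq: "G - (2 - p) * E = (\<Sum>a\<in>V. \<Sum>b\<in>V. ?h a b)"
      unfolding G_def E_def sum_distrib_left sum_subtractf[symmetric]
      by (intro sum.cong refl) simp
    \<comment> \<open>Symmetrising completes \<open>(m a b + m b a)\<^sup>2\<close>, the shape
      required by \<open>pair_inequalities(2)\<close>.\<close>
    have "0 \<le> (\<Sum>a\<in>V. \<Sum>b\<in>V. ?h a b + ?h b a)"
    proof (intro sum_nonneg)
      fix a b assume ab: "a \<in> V" "b \<in> V"
      show "0 \<le> ?h a b + ?h b a"
        using pair_inequalities(2)[OF ab, of "m a b" "m b a"]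
        by (auto simp: W_sym[of b a] power2_eq_square algebra_simps)
    qed
    also have "\<dots> = (\<Sum>a\<in>V. \<Sum>b\<in>V. ?h a b) + (\<Sum>a\<in>V. \<Sum>b\<in>V. ?h b a)"
      by (simp only: sum.distrib)
    also have "(\<Sum>a\<in>V. \<Sum>b\<in>V. ?h b a) = (\<Sum>a\<in>V. \<Sum>b\<in>V. ?h a b)"
      by (rule sum.swap)
    finally show ?thesis unfolding eq by simp
  qed
  with I1_ge have "(\<Sum>v\<in>V. (m v v)\<^sup>2 / u v * P v) - (2 - p) * D
      \<le> (\<Sum>w\<in>V. (norm (g w))\<^sup>2 * P w) - (2 - p) * (D + E)"
    by (simp add: algebra_simps)
  then have "F * ((\<Sum>v\<in>V. (m v v)\<^sup>2 / u v * P v) - (2 - p) * D)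
      \<le> F * ((\<Sum>w\<in>V. (norm (g w))\<^sup>2 * P w) - (2 - p) * (D + E))"
    using F_nonneg by (rule mult_left_mono)
  moreover have "0 \<le> F * ((\<Sum>v\<in>V. (m v v)\<^sup>2 / u v * P v) - (2 - p) * D) + (1 - p) * (\<Sum>v\<in>V. m v v * P v)\<^sup>2"
  proof -
    \<comment> \<open>The logarithmic derivative of \<open>norm (f a + t *\<^sub>R g a)\<close> at
      \<open>t = 0\<close>.\<close>
    define d where "d a = m a a / u a" for a
    have m: "m a a = u a * d a" if "a \<in> V" for a
      using u_pos[OF that] by (simp add: d_def)
    have "(\<Sum>v\<in>V. (m v v)\<^sup>2 / u v * P v) = (\<Sum>a\<in>V. u a * P a * (d a)\<^sup>2)"
      by (intro sum.cong refl) (use u_pos in \<open>force simp: m power2_eq_square\<close>)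
    moreover have "D = (\<Sum>a\<in>V. \<Sum>c\<in>V. u a * u c * d a * d c * W a c)"
      unfolding D_def by (intro sum.cong refl) (simp add: m)
    moreover have "(\<Sum>v\<in>V. m v v * P v) = (\<Sum>a\<in>V. u a * d a * P a)"
      by (intro sum.cong refl) (simp add: m)
    moreover have "0 \<le> F * ((\<Sum>a\<in>V. u a * P a * (d a)\<^sup>2)
        - (2 - p) * (\<Sum>a\<in>V. \<Sum>c\<in>V. u a * u c * d a * d c * W a c)) + (1 - p) * (\<Sum>a\<in>V. u a * d a * P a)\<^sup>2"
      by (rule diagonal_form_nonneg)
        (auto simp: W_sym W_row P_sum u_pos less_imp_le intro: pair_inequalities(1))
    ultimately show ?thesis by simp
  qed
  ultimately show ?thesis unfolding I1 I2 I3 by linarith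
qed

end

context invariant_sphere_measure
begin

text \<open>Right singular vectors are eigenvectors of the self-adjoint map \<open>adjoint f\<close>
  after \<open>f\<close>.\<close>

lemma singular_basis_exists:
  fixes f :: "'a \<Rightarrow> 'b::euclidean_space"
  assumes lin: "linear f" and inj: "\<And>x. f x = 0 \<Longrightarrow> x = 0" and p: "0 < p" "p < 1"
  obtains V where "singular_basis M f V p"
proof -
  define T where "T x = adjoint f (f x)" for x
  have T: "T x \<bullet> y = f x \<bullet> f y" for x y
    using adjoint_works[OF lin, of y "f x"] by (simp add: T_def inner_commute)
  have "linear T"
    using linear_compose[OF lin adjoint_linear[OF lin]] by (simp add: T_def[abs_def] o_def)
  moreover have "T x \<bullet> y = x \<bullet> T y" for x y
    using T[of x y] T[of y x] by (simp add: inner_commute)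
  ultimately obtain V where V: "finite V" "pairwise orthogonal V" "\<And>v. v \<in> V \<Longrightarrow> norm v = 1" "span V = UNIV"
    and eig: "\<And>v. v \<in> V \<Longrightarrow> \<exists>c. T v = c *\<^sub>R v"
    using orthonormal_eigenbasis by blast
  have orth: "f v \<bullet> f w = 0" if vw: "v \<in> V" "w \<in> V" "v \<noteq> w" for v w
  proof -
    obtain c where "T v = c *\<^sub>R v" using eig vw by blast
    then show ?thesis
      using vw V(2) by (simp add: pairwise_def orthogonal_def flip: T)
  qed
  have "singular_basis M f V p"
    by unfold_locales (fact linear_add[OF lin] linear_scale[OF lin] inj p V orth)+
  then show ?thesis by (rule that)
qed

end

subsection \<open>The Hardy norm of a linear map\<close>

context invariant_sphere_measure
begin

lemma integral_pos:
  fixes h :: "'a \<Rightarrow> real"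
  assumes cont: "continuous_on (sphere 0 1) h" and pos: "\<And>x. x \<in> sphere 0 1 \<Longrightarrow> 0 < h x"
  shows "0 < (\<integral>x. h x \<partial>M)"
proof -
  have "sphere 0 1 \<noteq> ({} :: 'a set)" by auto
  then obtain y where y: "y \<in> sphere 0 1" "\<And>x. x \<in> sphere 0 1 \<Longrightarrow> h y \<le> h x"
    using continuous_attains_inf[OF compact_S _ cont] by blast
  have "0 < measure M (space M) * h y"
    using total_pos pos[OF y(1)] by (simp add: space_M)
  also have "\<dots> = (\<integral>x. h y \<partial>M)" by simp
  also have "\<dots> \<le> (\<integral>x. h x \<partial>M)"
    using y(2) by (intro integral_mono integrable_continuous cont) (auto simp: space_M)
  finally show ?thesis .
qed

text \<open>Injectivity at every \<open>t\<close> keeps \<open>h t x\<close> positive on the sphere,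
  so \<open>H\<close> may be differentiated twice under the integral. The second derivative of
  \<open>H powr (1 / p)\<close> is a positive multiple of
  \<open>p * (H t * H2 t) + (1 - p) * (H1 t)\<^sup>2\<close>, whose sign comes from
  \<open>hessian_nonneg\<close>.\<close>

lemma convex_on_line:
  fixes f g :: "'a \<Rightarrow> 'b::euclidean_space"
  assumes lin: "linear f" "linear g" and inj: "\<And>t x. f x + t *\<^sub>R g x = 0 \<Longrightarrow> x = 0"
    and p: "0 < p" "p < 1"
  shows "convex_on UNIV (\<lambda>t. (\<integral>x. norm (f x + t *\<^sub>R g x) powr p \<partial>M) powr (1 / p))"
proof -
  define k where "k t x = f x + t *\<^sub>R g x" for t x
  define h where "h t x = (norm (k t x))\<^sup>2" for t x
  have hpos: "0 < h t x" if "x \<in> sphere 0 1" for t x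
    using inj[of x t] that by (auto simp: h_def k_def)
  have [continuous_intros]: "continuous_on UNIV f" "continuous_on UNIV g"
    using lin by (auto intro!: linear_continuous_on simp flip: linear_conv_bounded_linear)
  note cont_f = continuous_on_compose2[OF \<open>continuous_on UNIV f\<close> _ subset_UNIV]
    and cont_g = continuous_on_compose2[OF \<open>continuous_on UNIV g\<close> _ subset_UNIV]
  have cont_h: "continuous_on (UNIV \<times> sphere 0 1) (\<lambda>(t, x). h t x powr r)" for r
    unfolding case_prod_unfold
  proof (intro continuous_on_powr continuous_on_const ballI)
    show "continuous_on (UNIV \<times> sphere 0 1) (\<lambda>z. h (fst z) (snd z))"
      unfolding h_def k_def by (intro continuous_intros cont_f cont_g)
    show "h (fst z) (snd z) \<noteq> 0" if "z \<in> UNIV \<times> sphere 0 1" for z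
      using hpos[of "snd z" "fst z"] that by auto
  qed
  have cont_kg: "continuous_on S (\<lambda>(t, x). k t x \<bullet> g x)" and cont_gg: "continuous_on S (\<lambda>(t, x). (norm (g x))\<^sup>2)" for S
    unfolding case_prod_unfold k_def by (intro continuous_intros cont_f cont_g)+
  have slice: "continuous_on (sphere 0 1) (\<lambda>x. \<phi> t x)"
    if "continuous_on (UNIV \<times> sphere 0 1) (\<lambda>(t, x). \<phi> t x)" for \<phi> :: "real \<Rightarrow> 'a \<Rightarrow> real" and t
  proof -
    have "continuous_on (sphere 0 1) (\<lambda>x :: 'a. (t, x))"
      by (intro continuous_intros)
    from continuous_on_compose2[OF that this] show ?thesis by auto
  qed
  have dh: "((\<lambda>t. h t x) has_real_derivative 2 * (k t x \<bullet> g x)) (at t)" for t x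
  proof -
    have "(\<lambda>t. h t x) = (\<lambda>t. f x \<bullet> f x + 2 * t * (f x \<bullet> g x) + t\<^sup>2 * (g x \<bullet> g x))"
      unfolding fun_eq_iff h_def k_def power2_norm_eq_inner
      by (simp add: inner_add_left inner_add_right inner_commute[of "g x" "f x"] power2_eq_square algebra_simps)
    then show ?thesis
      by (auto intro!: derivative_eq_intros simp: k_def inner_add_left algebra_simps)
  qed
  have dk: "((\<lambda>t. k t x \<bullet> g x) has_real_derivative (norm (g x))\<^sup>2) (at t)" for t x
    unfolding k_def inner_add_left power2_norm_eq_inner
    by (auto intro!: derivative_eq_intros)
  define H where "H t = (\<integral>x. h t x powr (p / 2) \<partial>M)" for t
  define H1 where "H1 t = (\<integral>x. p * ((k t x \<bullet> g x) * h t x powr (p / 2 - 1)) \<partial>M)" for t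
  define H2 where "H2 t = (\<integral>x. p * ((norm (g x))\<^sup>2 * h t x powr (p / 2 - 1)
      - (2 - p) * ((k t x \<bullet> g x)\<^sup>2 * h t x powr (p / 2 - 2))) \<partial>M)" for t
  have c0: "continuous_on (UNIV \<times> sphere 0 1) (\<lambda>(t, x). h t x powr (p / 2))"
    by (rule cont_h)
  have c1: "continuous_on (UNIV \<times> sphere 0 1) (\<lambda>(t, x). p * ((k t x \<bullet> g x) * h t x powr (p / 2 - 1)))"
    using continuous_on_mult[OF cont_kg cont_h] unfolding case_prod_unfold by (rule continuous_on_mult_left)
  have c21: "continuous_on (UNIV \<times> sphere 0 1) (\<lambda>(t, x). (norm (g x))\<^sup>2 * h t x powr (p / 2 - 1))"
    using continuous_on_mult[OF cont_gg cont_h] unfolding case_prod_unfold .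
  have c22: "continuous_on (UNIV \<times> sphere 0 1) (\<lambda>(t, x). (k t x \<bullet> g x)\<^sup>2 * h t x powr (p / 2 - 2))"
    using continuous_on_mult[OF continuous_on_power[OF cont_kg] cont_h] unfolding case_prod_unfold .
  have c2: "continuous_on (UNIV \<times> sphere 0 1) (\<lambda>(t, x). p * ((norm (g x))\<^sup>2 * h t x powr (p / 2 - 1)
      - (2 - p) * ((k t x \<bullet> g x)\<^sup>2 * h t x powr (p / 2 - 2))))"
    using c21 c22 unfolding case_prod_unfold by (intro continuous_on_mult_left continuous_on_diff)
  have dH: "(H has_real_derivative H1 t) (at t)" for t
    unfolding H_def[abs_def] H1_def
  proof (rule has_derivative_integral[OF _ slice[OF c0] c1])
    fix x :: 'a and t assume "x \<in> sphere 0 1"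
    then show "((\<lambda>t. h t x powr (p / 2)) has_real_derivative p * ((k t x \<bullet> g x) * h t x powr (p / 2 - 1))) (at t)"
      using hpos[of x t] by (auto intro!: derivative_eq_intros dh)
  qed
  have dH1: "(H1 has_real_derivative H2 t) (at t)" for t
    unfolding H1_def[abs_def] H2_def
  proof (rule has_derivative_integral[OF _ slice[OF c1] c2])
    fix x :: 'a and t assume "x \<in> sphere 0 1"
    then show "((\<lambda>t. p * ((k t x \<bullet> g x) * h t x powr (p / 2 - 1))) has_real_derivative
      p * ((norm (g x))\<^sup>2 * h t x powr (p / 2 - 1) - (2 - p) * ((k t x \<bullet> g x)\<^sup>2 * h t x powr (p / 2 - 2)))) (at t)"
      using hpos[of x t]
      by (auto intro!: derivative_eq_intros dh dk simp: power2_eq_square algebra_simps)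
  qed
  have Hpos: "0 < H t" for t
    unfolding H_def using hpos by (intro integral_pos slice c0) (simp add: powr_gt_zero less_imp_neq[symmetric])
  have hess: "0 \<le> p * (H t * H2 t) + (1 - p) * (H1 t)\<^sup>2" for t
  proof -
    have "linear (k t)"
      unfolding k_def[abs_def] using lin by (intro linear_compose_add linear_compose_scale_right)
    then obtain V where "singular_basis M (k t) V p"
      using singular_basis_exists[of "k t"] inj p unfolding k_def by blast
    then interpret S: singular_basis M "k t" V p .
    have q: "S.q = h t" by (simp add: fun_eq_iff S.q_def h_def)
    have i: "integrable M (\<lambda>x. (norm (g x))\<^sup>2 * h t x powr (p / 2 - 1))"
      "integrable M (\<lambda>x. (k t x \<bullet> g x)\<^sup>2 * h t x powr (p / 2 - 2))"
      by (intro integrable_continuous slice c21 c22)+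
    have factor: "p * (a * (p * b)) + (1 - p) * (p * c)\<^sup>2 = p\<^sup>2 * (a * b + (1 - p) * c\<^sup>2)" for a b c
      by algebra
    have "H t = S.F" by (simp add: H_def S.F_def q)
    moreover have "H1 t = p * (\<integral>x. (k t x \<bullet> g x) * h t x powr (p / 2 - 1) \<partial>M)"
      by (simp add: H1_def)
    moreover have "H2 t = p * ((\<integral>x. (norm (g x))\<^sup>2 * h t x powr (p / 2 - 1) \<partial>M)
        - (2 - p) * (\<integral>x. (k t x \<bullet> g x)\<^sup>2 * h t x powr (p / 2 - 2) \<partial>M))"
      using i by (simp add: H2_def)
    ultimately have "p * (H t * H2 t) + (1 - p) * (H1 t)\<^sup>2
      = p\<^sup>2 * (S.F * ((\<integral>x. (norm (g x))\<^sup>2 * S.q x powr (p / 2 - 1) \<partial>M)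
        - (2 - p) * (\<integral>x. (k t x \<bullet> g x)\<^sup>2 * S.q x powr (p / 2 - 2) \<partial>M))
      + (1 - p) * (\<integral>x. (k t x \<bullet> g x) * S.q x powr (p / 2 - 1) \<partial>M)\<^sup>2)"
      unfolding q by (simp only: factor)
    then show ?thesis using S.hessian_nonneg[OF lin(2)] by simp
  qed
  have "convex_on UNIV (\<lambda>t. H t powr (1 / p))"
  proof (rule f''_ge0_imp_convex)
    fix t :: real
    show "((\<lambda>t. H t powr (1 / p)) has_real_derivative 1 / p * H t powr (1 / p - 1) * H1 t) (at t)"
      using Hpos[of t] by (auto intro!: derivative_eq_intros dH)
    show "((\<lambda>t. 1 / p * H t powr (1 / p - 1) * H1 t) has_real_derivative
        1 / p * ((1 / p - 1) * H t powr (1 / p - 2) * (H1 t)\<^sup>2 + H t powr (1 / p - 1) * H2 t)) (at t)"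
      using Hpos[of t] p
      by (auto intro!: derivative_eq_intros dH dH1 simp: power2_eq_square algebra_simps)
        (simp add: field_simps)
    have "H t powr (1 / p - 1) = H t powr (1 / p - 2) * H t"
      using powr_add[of "H t" "1 / p - 2" 1] Hpos[of t] by simp
    then have "1 / p * ((1 / p - 1) * H t powr (1 / p - 2) * (H1 t)\<^sup>2 + H t powr (1 / p - 1) * H2 t)
      = H t powr (1 / p - 2) * (p * (H t * H2 t) + (1 - p) * (H1 t)\<^sup>2) / p\<^sup>2"
      using p by (simp add: field_simps power2_eq_square)
    also have "\<dots> \<ge> 0" using hess by simp
    finally show "0 \<le> 1 / p * ((1 / p - 1) * H t powr (1 / p - 2) * (H1 t)\<^sup>2 + H t powr (1 / p - 1) * H2 t)" .
  qed simp
  moreover have "H t = (\<integral>x. norm (f x + t *\<^sub>R g x) powr p \<partial>M)" for t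
    by (simp add: H_def h_def k_def powr_powr flip: powr_numeral)
  ultimately show ?thesis by simp
qed

section \<open>Norm properties of \<open>Hp\<close> on linear maps\<close>

definition Hp :: "real \<Rightarrow> ('a \<Rightarrow> 'b::euclidean_space) \<Rightarrow> real" where
  "Hp p f = (\<integral>x. norm (f x) powr p \<partial>M) powr (1 / p)"

lemma continuous_on_linear: "linear f \<Longrightarrow> continuous_on S f" for f :: "'a \<Rightarrow> 'b::euclidean_space"
  by (simp add: linear_continuous_on linear_conv_bounded_linear)

lemma integrable_norm_powr:
  fixes f :: "'a \<Rightarrow> 'b::euclidean_space"
  assumes "linear f" "0 < p"
  shows "integrable M (\<lambda>x. norm (f x) powr p)"
  using assms by (intro integrable_continuous continuous_on_powr' continuous_intros continuous_on_linear) auto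

lemma Hp_nonneg: "0 \<le> Hp p f"
  by (simp add: Hp_def)

lemma Hp_powr: "0 < p \<Longrightarrow> Hp p f powr p = (\<integral>x. norm (f x) powr p \<partial>M)"
  by (simp add: Hp_def powr_powr)

lemma Hp_scale:
  assumes "0 < p"
  shows "Hp p (\<lambda>x. c *\<^sub>R f x) = \<bar>c\<bar> * Hp p f"
  using assms by (simp add: Hp_def powr_mult powr_powr)

text \<open>Appending the coordinate \<open>e n *\<^sub>R x\<close> makes the maps injective, so
  \<open>convex_on_line\<close> applies; the perturbation is then removed by dominated convergence
  as \<open>e n\<close> tends to 0.\<close>

lemma Hp_midpoint_le:
  fixes f g :: "'a \<Rightarrow> 'b::euclidean_space"
  assumes lin: "linear f" "linear g" and p: "0 < p" "p < 1"
  shows "Hp p (\<lambda>x. (1 / 2) *\<^sub>R (f x + g x)) \<le> (Hp p f + Hp p g) / 2"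
proof -
  define e :: "nat \<Rightarrow> real" where "e n = 1 / real (Suc n)" for n
  have e: "0 < e n" "e n \<le> 1" "e \<longlonglongrightarrow> 0" for n
    using LIMSEQ_inverse_real_of_nat by (auto simp: e_def[abs_def] inverse_eq_divide)
  have lim: "(\<lambda>n. Hp p (\<lambda>x. (h x, e n *\<^sub>R x))) \<longlonglongrightarrow> Hp p h" if "linear h" for h :: "'a \<Rightarrow> 'b"
  proof -
    have "(\<lambda>n. \<integral>x. norm (h x, e n *\<^sub>R x) powr p \<partial>M) \<longlonglongrightarrow> (\<integral>x. norm (h x) powr p \<partial>M)"
    proof (rule integral_dominated_convergence[where w = "\<lambda>x. (norm (h x) + 1) powr p"])
      show "integrable M (\<lambda>x. (norm (h x) + 1) powr p)"
        using that p by (intro integrable_continuous continuous_on_powr' continuous_intros continuous_on_linear)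
          (auto intro: add_nonneg_nonneg)
      have "linear (\<lambda>x. (h x, e n *\<^sub>R x))" for n
        using that by (simp add: linear_iff algebra_simps)
      then show "(\<lambda>x. norm (h x, e n *\<^sub>R x) powr p) \<in> borel_measurable M" for n
        using integrable_norm_powr[of "\<lambda>x. (h x, e n *\<^sub>R x)"] p by auto
      show "(\<lambda>x. norm (h x) powr p) \<in> borel_measurable M"
        using integrable_norm_powr[OF that] p by auto
      show "AE x in M. norm (norm (h x, e n *\<^sub>R x) powr p) \<le> (norm (h x) + 1) powr p" for n
      proof (intro AE_I2)
        fix x assume "x \<in> space M"
        then have "norm (e n *\<^sub>R x) \<le> 1" using e(1)[of n] e(2)[of n] by (simp add: space_M)
        then have "norm (h x, e n *\<^sub>R x) \<le> norm (h x) + 1"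
          using norm_Pair_le[of "h x" "e n *\<^sub>R x"] by linarith
        then show "norm (norm (h x, e n *\<^sub>R x) powr p) \<le> (norm (h x) + 1) powr p"
          using p by (simp add: powr_mono2)
      qed
      show "AE x in M. (\<lambda>n. norm (h x, e n *\<^sub>R x) powr p) \<longlonglongrightarrow> norm (h x) powr p"
      proof (intro AE_I2)
        fix x
        have "(\<lambda>n. norm (h x, e n *\<^sub>R x)) \<longlonglongrightarrow> norm (h x, 0 *\<^sub>R x)"
          by (intro tendsto_intros e)
        then have "(\<lambda>n. norm (h x, e n *\<^sub>R x)) \<longlonglongrightarrow> norm (h x)" by (simp add: norm_Pair)
        then show "(\<lambda>n. norm (h x, e n *\<^sub>R x) powr p) \<longlonglongrightarrow> norm (h x) powr p"
          using p by (intro tendsto_powr' tendsto_const) auto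
      qed
    qed
    then show ?thesis
      unfolding Hp_def using p by (intro tendsto_powr' tendsto_const) auto
  qed
  have lin2: "linear (\<lambda>x. (1 / 2) *\<^sub>R (f x + g x))"
    using lin by (intro linear_compose_scale_right linear_compose_add)
  have "Hp p (\<lambda>x. ((1 / 2) *\<^sub>R (f x + g x), e n *\<^sub>R x))
      \<le> (Hp p (\<lambda>x. (f x, e n *\<^sub>R x)) + Hp p (\<lambda>x. (g x, e n *\<^sub>R x))) / 2" for n
  proof -
    \<comment> \<open>The direction \<open>?g\<close> has second component 0, so the appended
      coordinate is the same along the whole line and every map on it is injective.\<close>
    let ?f = "\<lambda>x. (f x, e n *\<^sub>R x)" and ?g = "\<lambda>x. (g x - f x, 0 :: 'a)"
    have "convex_on UNIV (\<lambda>t. (\<integral>x. norm (?f x + t *\<^sub>R ?g x) powr p \<partial>M) powr (1 / p))"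
    proof (rule convex_on_line)
      show "linear ?f" "linear ?g"
        using lin by (simp_all add: linear_iff algebra_simps)
      show "x = 0" if "?f x + t *\<^sub>R ?g x = 0" for t x
        using that e(1)[of n] by (simp add: prod_eq_iff)
    qed (use p in auto)
    from convex_onD[OF this, of "1/2" 0 1]
    have "(\<integral>x. norm (?f x + (1 / 2) *\<^sub>R ?g x) powr p \<partial>M) powr (1 / p)
      \<le> (1 / 2) * (\<integral>x. norm (?f x) powr p \<partial>M) powr (1 / p)
        + (1 / 2) * (\<integral>x. norm (?f x + ?g x) powr p \<partial>M) powr (1 / p)"
      by simp
    moreover have "?f x + (1 / 2) *\<^sub>R ?g x = ((1 / 2) *\<^sub>R (f x + g x), e n *\<^sub>R x)" for x
      by (simp add: algebra_simps flip: scaleR_left_distrib)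
    moreover have "?f x + ?g x = (g x, e n *\<^sub>R x)" for x by simp
    ultimately show ?thesis by (simp add: Hp_def)
  qed
  moreover have "(\<lambda>n. (Hp p (\<lambda>x. (f x, e n *\<^sub>R x)) + Hp p (\<lambda>x. (g x, e n *\<^sub>R x))) / 2)
      \<longlonglongrightarrow> (Hp p f + Hp p g) / 2"
    by (intro tendsto_divide tendsto_add lim lin tendsto_const) simp
  ultimately show ?thesis
    using LIMSEQ_le[OF lim[OF lin2]] by blast
qed

text \<open>The tangent line of \<open>x powr p\<close> at 1 lies below the graph, by Young's
  inequality. Applied to \<open>a / m\<close> and \<open>b / m\<close>, with \<open>m\<close> the
  weighted mean, the linear terms average out to 1.\<close>

lemma powr_convex_combination:
  fixes p l a b :: real
  assumes p: "1 \<le> p" and l: "0 \<le> l" "l \<le> 1" and ab: "0 \<le> a" "0 \<le> b"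
  shows "(l * a + (1 - l) * b) powr p \<le> l * a powr p + (1 - l) * b powr p"
proof (cases "l * a + (1 - l) * b = 0")
  case False
  define m where "m = l * a + (1 - l) * b"
  have m: "0 < m" using False l ab by (simp add: m_def order_less_le)
  have tangent: "p * x - p + 1 \<le> x powr p" if "0 \<le> x" for x
  proof (cases "x = 0")
    case False
    then have "x \<le> 1 / p * x powr p + (1 - 1 / p)"
      using Youngs_inequality_0[of "1 / p" "1 - 1 / p" "x powr p" 1] p that by (simp add: powr_powr)
    then have "p * x \<le> p * (1 / p * x powr p + (1 - 1 / p))"
      using p by (intro mult_left_mono) auto
    then show ?thesis using p by (simp add: algebra_simps)
  qed (use p in simp)
  have "m powr p = m powr p * (l * (p * (a / m) - p + 1) + (1 - l) * (p * (b / m) - p + 1))"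
  proof -
    have "l * (p * (a / m) - p + 1) + (1 - l) * (p * (b / m) - p + 1) = p * (m / m) - p + 1"
      unfolding m_def add_divide_distrib by (simp add: algebra_simps)
    then show ?thesis using m by simp
  qed
  also have "\<dots> \<le> m powr p * (l * (a / m) powr p + (1 - l) * (b / m) powr p)"
    using l ab m by (intro mult_left_mono add_mono tangent) auto
  also have "\<dots> = l * a powr p + (1 - l) * b powr p"
    using m ab by (simp add: powr_divide field_simps)
  finally show ?thesis by (simp add: m_def)
qed (use l ab in simp)

text \<open>Minkowski by normalisation: \<open>norm (f x) + norm (g x)\<close> is
  \<open>a + b\<close> times a convex combination of \<open>norm (f x) / a\<close> and
  \<open>norm (g x) / b\<close>, and convexity of the power is integrated.\<close>

lemma Hp_triangle_ge1:
  fixes f g :: "'a \<Rightarrow> 'b::euclidean_space"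
  assumes lin: "linear f" "linear g" and p: "1 \<le> p"
  shows "Hp p (\<lambda>x. f x + g x) \<le> Hp p f + Hp p g"
proof (rule field_le_epsilon)
  fix e :: real assume e: "0 < e"
  \<comment> \<open>The summand \<open>e / 2\<close> keeps the divisors positive even if a norm is
    zero.\<close>
  define a b where "a = Hp p f + e / 2" and "b = Hp p g + e / 2"
  have ab: "0 < a" "0 < b" using e Hp_nonneg[of p f] Hp_nonneg[of p g] by (simp_all add: a_def b_def)
  define l where "l = a / (a + b)"
  have l: "0 \<le> l" "l \<le> 1" and l': "1 - l = b / (a + b)"
    using ab by (simp_all add: l_def field_simps)
  have p0: "0 < p" using p by simp
  have le: "(\<integral>x. norm (h x) powr p \<partial>M) / c powr p \<le> 1" if "Hp p h \<le> c" "0 < c" for h :: "'a \<Rightarrow> 'b" and c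
    using powr_mono2[of p "Hp p h" c] p0 that Hp_nonneg[of p h] by (simp add: Hp_powr)
  note i = integrable_norm_powr[OF _ p0]
  have lfg: "linear (\<lambda>x. f x + g x)" using lin by (rule linear_compose_add)
  have pt: "norm (f x + g x) powr p
      \<le> (a + b) powr p * (l * (norm (f x) powr p / a powr p) + (1 - l) * (norm (g x) powr p / b powr p))" for x
  proof -
    have "(a + b) * l = a" using ab by (simp add: l_def)
    moreover have "(a + b) * (1 - l) = b" unfolding l' using ab by simp
    ultimately have "(a + b) * (l * (norm (f x) / a) + (1 - l) * (norm (g x) / b)) = norm (f x) + norm (g x)"
      using ab by (simp only: distrib_left mult.assoc[symmetric]) simp
    then have "norm (f x + g x) \<le> (a + b) * (l * (norm (f x) / a) + (1 - l) * (norm (g x) / b))"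
      using norm_triangle_ineq[of "f x" "g x"] by simp
    then have "norm (f x + g x) powr p \<le> ((a + b) * (l * (norm (f x) / a) + (1 - l) * (norm (g x) / b))) powr p"
      using p0 by (intro powr_mono2) auto
    also have "\<dots> = (a + b) powr p * (l * (norm (f x) / a) + (1 - l) * (norm (g x) / b)) powr p"
      by (rule powr_mult)
    also have "\<dots> \<le> (a + b) powr p * (l * (norm (f x) / a) powr p + (1 - l) * (norm (g x) / b) powr p)"
      using ab l p by (intro mult_left_mono powr_convex_combination) auto
    finally show ?thesis using ab by (simp add: powr_divide)
  qed
  have "(\<integral>x. norm (f x + g x) powr p \<partial>M)
      \<le> (\<integral>x. (a + b) powr p * (l * (norm (f x) powr p / a powr p) + (1 - l) * (norm (g x) powr p / b powr p)) \<partial>M)"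
    using i[OF lin(1)] i[OF lin(2)]
    by (intro integral_mono i[OF lfg] pt integrable_mult_right Bochner_Integration.integrable_add integrable_divide) auto
  also have "\<dots> = (a + b) powr p * (l * ((\<integral>x. norm (f x) powr p \<partial>M) / a powr p)
      + (1 - l) * ((\<integral>x. norm (g x) powr p \<partial>M) / b powr p))"
    using i[OF lin(1)] i[OF lin(2)] by (simp del: times_divide_eq_right)
  also have "\<dots> \<le> (a + b) powr p * (l * 1 + (1 - l) * 1)"
    using l ab e by (intro mult_left_mono add_mono le) (auto simp: a_def b_def)
  finally have "(\<integral>x. norm (f x + g x) powr p \<partial>M) powr (1 / p) \<le> ((a + b) powr p) powr (1 / p)"
    using p0 by (intro powr_mono2) auto
  then show "Hp p (\<lambda>x. f x + g x) \<le> Hp p f + Hp p g + e"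
    using ab p0 by (simp add: Hp_def[of p "\<lambda>x. f x + g x"] powr_powr a_def b_def)
qed

lemma Hp_triangle:
  fixes f g :: "'a \<Rightarrow> 'b::euclidean_space"
  assumes lin: "linear f" "linear g" and p: "0 < p"
  shows "Hp p (\<lambda>x. f x + g x) \<le> Hp p f + Hp p g"
proof (cases "p < 1")
  case True
  then show ?thesis
    using Hp_midpoint_le[OF lin p True] Hp_scale[OF p, of "1 / 2" "\<lambda>x. f x + g x"] by simp
qed (use Hp_triangle_ge1[OF lin] in simp)

text \<open>The reflection along \<open>a - b\<close> exchanges the unit vectors \<open>a\<close>
  and \<open>b\<close> and preserves \<open>M\<close>.\<close>

lemma integral_inner_sq:
  assumes a: "norm a = 1" and b: "norm b = 1"
  shows "(\<integral>x. (x \<bullet> a)\<^sup>2 \<partial>M) = (\<integral>x. (x \<bullet> b)\<^sup>2 \<partial>M)"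
proof (cases "a = b")
  case False
  define v where "v = (a - b) /\<^sub>R norm (a - b)"
  have "norm v = 1" using False by (simp add: v_def)
  then have vv: "v \<bullet> v = 1" by (simp add: norm_eq_1)
  have ab: "a \<bullet> a = 1" "b \<bullet> b = 1" using a b by (simp_all add: norm_eq_1)
  have n2: "(norm (a - b))\<^sup>2 = 2 - 2 * (a \<bullet> b)"
    using ab by (simp add: power2_norm_eq_inner inner_diff_left inner_diff_right inner_commute)
  have "reflect v b = b - (2 * (a \<bullet> b - 1) / (norm (a - b))\<^sup>2) *\<^sub>R (a - b)"
    by (simp add: reflect_def v_def inner_diff_right ab inner_commute power2_eq_square divide_inverse mult_ac)
  also have "2 * (a \<bullet> b - 1) / (norm (a - b))\<^sup>2 = - 1"
  proof -
    have "2 * (a \<bullet> b - 1) = - (norm (a - b))\<^sup>2" using n2 by simp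
    then show ?thesis using False by simp
  qed
  finally have rb: "reflect v b = a" by simp
  note T = orthogonal_reflect[OF vv]
  have "(\<integral>x. (reflect v x \<bullet> a)\<^sup>2 \<partial>M) = (\<integral>x. (x \<bullet> a)\<^sup>2 \<partial>M)"
    by (intro integral_orthogonal[OF T] continuous_intros)
  moreover have "reflect v x \<bullet> a = x \<bullet> b" for x
    using T by (simp add: orthogonal_transformation_def flip: rb)
  ultimately show ?thesis by simp
qed simp

text \<open>If \<open>f\<close> vanishes almost everywhere without being zero, then
  \<open>x \<bullet> a\<close> vanishes almost everywhere for some unit vector \<open>a\<close>. By
  invariance all second moments are then zero, although over a basis they add up to the positive
  total mass.\<close>

lemma Hp_eq_0_iff:
  fixes f :: "'a \<Rightarrow> 'b::euclidean_space"
  assumes lin: "linear f" and p: "0 < p"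
  shows "Hp p f = 0 \<longleftrightarrow> (\<forall>x. f x = 0)"
proof
  assume 0: "Hp p f = 0"
  show "\<forall>x. f x = 0"
  proof (rule ccontr)
    assume "\<not> (\<forall>x. f x = 0)"
    then obtain y where y: "f y \<noteq> 0" by blast
    \<comment> \<open>Chosen so that \<open>x \<bullet> c = f x \<bullet> f y\<close>: it vanishes
      wherever \<open>f\<close> does, and is nonzero at \<open>x = y\<close>.\<close>
    define c where "c = adjoint f (f y)"
    have fc: "x \<bullet> c = f x \<bullet> f y" for x
      using adjoint_works[OF lin, of x "f y"] by (simp add: c_def)
    have "c \<noteq> 0" using fc[of y] y by auto
    define a where "a = c /\<^sub>R norm c"
    have a: "norm a = 1" using \<open>c \<noteq> 0\<close> by (simp add: a_def)
    have "(\<integral>x. norm (f x) powr p \<partial>M) = 0"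
      using 0 p by (simp add: Hp_def)
    then have "AE x in M. norm (f x) powr p = 0"
      using integral_nonneg_eq_0_iff_AE[OF integrable_norm_powr[OF lin p]] by simp
    then have "AE x in M. (x \<bullet> a)\<^sup>2 = 0"
      by (rule AE_mp) (auto simp: a_def fc)
    then have za: "(\<integral>x. (x \<bullet> a)\<^sup>2 \<partial>M) = 0"
      by (rule integral_eq_zero_AE)
    have "measure M (space M) = (\<integral>x. (\<Sum>b\<in>Basis. (x \<bullet> b)\<^sup>2) \<partial>M)"
    proof -
      have "(\<integral>x. (\<Sum>b\<in>Basis. (x \<bullet> b)\<^sup>2) \<partial>M) = (\<integral>x. 1 \<partial>M)"
      proof (intro Bochner_Integration.integral_cong refl)
        fix x assume "x \<in> space M"
        then have "x \<bullet> x = 1" by (simp add: space_M norm_eq_1)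
        then show "(\<Sum>b\<in>Basis. (x \<bullet> b)\<^sup>2) = 1"
          by (simp add: euclidean_inner[of x x] power2_eq_square)
      qed
      then show ?thesis by simp
    qed
    also have "\<dots> = (\<Sum>b\<in>Basis. \<integral>x. (x \<bullet> b)\<^sup>2 \<partial>M)"
      by (intro Bochner_Integration.integral_sum integrable_continuous continuous_intros)
    also have "\<dots> = 0"
      by (intro sum.neutral ballI) (use integral_inner_sq[OF a] za in auto)
    finally show False using total_pos by (simp add: space_M)
  qed
qed (simp add: Hp_def)

end

section \<open>Application to square matrices\<close>

lemma orthogonal_transformation_mult_vec:
  fixes U :: "real^'n^'n"
  assumes "orthogonal_matrix U"
  shows "orthogonal_transformation (\<lambda>x. U *v x)"
  using assms by (simp add: orthogonal_transformation_matrix matrix_of_matrix_vector_mul)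

theorem theorem5p1:
  fixes p :: real
  assumes "CARD('n::finite) \<ge> 2" and "0 < p"
  shows "is_norm (Hp_norm p :: real^'n^'n \<Rightarrow> real)
       \<and> orthogonally_invariant (Hp_norm p :: real^'n^'n \<Rightarrow> real)"
proof
  interpret invariant_sphere_measure "sphere_prob :: (real^'n) measure"
    by (rule invariant_sphere_prob)
  have Hp: "Hp_norm p A = Hp p (\<lambda>x. A *v x)" for A :: "real^'n^'n"
    by (simp add: Hp_norm_def Hp_def)
  note lin = matrix_vector_mul_linear
  show "is_norm (Hp_norm p :: real^'n^'n \<Rightarrow> real)"
    unfolding is_norm_def Hp
  proof (intro conjI allI)
    fix A B :: "real^'n^'n" and c :: real
    show "0 \<le> Hp p (\<lambda>x. A *v x)" by (rule Hp_nonneg)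
    show "Hp p (\<lambda>x. A *v x) = 0 \<longleftrightarrow> A = 0"
      by (simp add: Hp_eq_0_iff[OF lin \<open>0 < p\<close>] matrix_eq[of A 0])
    show "Hp p (\<lambda>x. (c *\<^sub>R A) *v x) = \<bar>c\<bar> * Hp p (\<lambda>x. A *v x)"
      by (simp add: Hp_scale[OF \<open>0 < p\<close>] flip: scaleR_matrix_vector_assoc)
    show "Hp p (\<lambda>x. (A + B) *v x) \<le> Hp p (\<lambda>x. A *v x) + Hp p (\<lambda>x. B *v x)"
      using Hp_triangle[OF lin[of A] lin[of B] \<open>0 < p\<close>] by (simp add: matrix_vector_mult_add_rdistrib)
  qed
  show "orthogonally_invariant (Hp_norm p :: real^'n^'n \<Rightarrow> real)"
    unfolding orthogonally_invariant_def
  proof (intro allI impI)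
    fix A U V :: "real^'n^'n"
    assume UV: "orthogonal_matrix U" "orthogonal_matrix V"
    have cont: "continuous_on (sphere 0 1) (\<lambda>x. norm (A *v x) powr p)"
      using \<open>0 < p\<close> by (intro continuous_on_powr' continuous_intros) auto
    \<comment> \<open>The left factor drops out pointwise because \<open>U\<close> preserves the
      norm; the right factor is removed by invariance of the measure.\<close>
    have "norm ((U ** A ** V) *v x) = norm (A *v (V *v x))" for x
      using orthogonal_transformation_norm[OF orthogonal_transformation_mult_vec[OF UV(1)]]
      by (simp flip: matrix_vector_mul_assoc)
    then show "Hp_norm p (U ** A ** V) = Hp_norm p A"
      using integral_orthogonal[OF orthogonal_transformation_mult_vec[OF UV(2)] cont]
      by (simp add: Hp_norm_def)
  qed
qed

end
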